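(* Let $|q|<1$ and let $\lambda=(\lambda_1,\dots,\lambda_m)$ be a partition of length $m$. Then $$Q_\lambda(1,q,q^2,\dots)=\prod_{i=1}^m\frac{(-1;q)_{\lambda_i}}{(q;q)_{\lambda_i}}\prod_{1\le i<j\le m}\frac{q^{\lambda_j}-q^{\lambda_i}}{1-q^{\lambda_i+\lambda_j}},$$ where the left-hand side is interpreted as $\lim_{n\to\infty}Q_\lambda(1,q,\dots,q^n)$.
   Context: $(a;q)_k=(1-a)(1-aq)\cdots(1-aq^{k-1})$. A partition of length $m$ is a sequence of integers $\lambda_1\ge\dots\ge\lambda_m>0$. For $m\le N$, the Schur $Q$-polynomial is the symmetric polynomial $$Q_\lambda(x_1,\dots,x_N)=2^m\sum_{\sigma\in S_N/S_{N-m}}\sigma\Bigg(x_1^{\lambda_1}\cdots x_m^{\lambda_m}\prod_{\substack{1\le i\le m\\ i<j\le N}}\frac{x_i+x_j}{x_i-x_j}\Bigg),$$ where $S_N$ acts by permuting the variables and $S_{N-m}$ is the subgroup permuting $x_{m+1},\dots,x_N$. *)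

theory Defs
  imports
    "HOL-Analysis.Analysis"
    "HOL-Library.Poly_Mapping"
    "HOL-Combinatorics.Permutations"
    "HOL-Computational_Algebra.Fraction_Field"
begin

definition qpoch :: "complex \<Rightarrow> complex \<Rightarrow> nat \<Rightarrow> complex" where
  "qpoch a q k = (\<Prod>i<k. 1 - a * q ^ i)"

text \<open>The length of the partition is the length of the list; the empty partition is allowed.\<close>

definition is_partition :: "nat list \<Rightarrow> bool" where
  "is_partition ls \<longleftrightarrow> sorted_wrt (\<ge>) ls \<and> (\<forall>k\<in>set ls. 0 < k)"

text \<open>
  Polynomials in the variables \<open>x\<^sub>0, x\<^sub>1, \<dots>\<close>: a monomial is a finitely supported
  exponent function and a polynomial is a finitely supported family of coefficients.
  Variables and parts are numbered from \<open>0\<close>, so that \<open>X i\<close> and \<open>ls ! i\<close> stand for what is usually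
  written \<open>x\<^sub>i\<^sub>+\<^sub>1\<close> and \<open>\<lambda>\<^sub>i\<^sub>+\<^sub>1\<close>.
\<close>

type_synonym cpoly = "(nat \<Rightarrow>\<^sub>0 nat) \<Rightarrow>\<^sub>0 complex"

definition poly_var :: "nat \<Rightarrow> cpoly" where
  "poly_var i = Poly_Mapping.single (Poly_Mapping.single i 1) 1"

definition poly_eval :: "(nat \<Rightarrow> complex) \<Rightarrow> cpoly \<Rightarrow> complex" where
  "poly_eval a p = (\<Sum>\<mu>\<in>Poly_Mapping.keys p. Poly_Mapping.lookup p \<mu> *
     (\<Prod>i\<in>Poly_Mapping.keys \<mu>. a i ^ Poly_Mapping.lookup \<mu> i))"

definition X :: "nat \<Rightarrow> cpoly fract" where
  "X i = Fract (poly_var i) 1"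

text \<open>The rational function inside the sum, after letting \<open>\<sigma>\<close> act by \<open>X i \<mapsto> X (\<sigma> i)\<close>.\<close>

definition schur_Q_term :: "nat \<Rightarrow> nat list \<Rightarrow> (nat \<Rightarrow> nat) \<Rightarrow> cpoly fract" where
  "schur_Q_term N ls \<sigma> =
     (\<Prod>i<length ls. X (\<sigma> i) ^ (ls ! i)) *
     (\<Prod>i<length ls. \<Prod>j\<in>{i<..<N}. (X (\<sigma> i) + X (\<sigma> j)) / (X (\<sigma> i) - X (\<sigma> j)))"

text \<open>
  The set of left cosets of the permutations of \<open>{m..<N}\<close> in the permutations of \<open>{..<N}\<close>.
\<close>

definition perm_cosets :: "nat \<Rightarrow> nat \<Rightarrow> (nat \<Rightarrow> nat) set set" where
  "perm_cosets N m =
     (\<lambda>\<sigma>. {\<sigma> \<circ> \<pi> | \<pi>. \<pi> permutes {m..<N}}) ` {\<sigma>. \<sigma> permutes {..<N}}"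

text \<open>The summand depends only on the coset, so any representative may be chosen below.\<close>

lemma schur_Q_term_coset:
  assumes "\<pi> permutes {length ls..<N}"
  shows "schur_Q_term N ls (\<sigma> \<circ> \<pi>) = schur_Q_term N ls \<sigma>"
proof -
  have fix_low: "\<pi> i = i" if "i < length ls" for i
    using assms that by (auto simp: permutes_def)
  have inner: "(\<Prod>j\<in>{i<..<N}. g (\<pi> j)) = (\<Prod>j\<in>{i<..<N}. g j)"
    if "i < length ls" for i and g :: "nat \<Rightarrow> cpoly fract"
  proof -
    have "\<pi> permutes {i<..<N}"
      using assms by (rule permutes_subset) (use that in auto)
    from prod.permute[OF this, of g] show ?thesis by (simp add: o_def)
  qed
  have "(\<Prod>j\<in>{i<..<N}. (X (\<sigma> (\<pi> i)) + X (\<sigma> (\<pi> j))) / (X (\<sigma> (\<pi> i)) - X (\<sigma> (\<pi> j)))) =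
        (\<Prod>j\<in>{i<..<N}. (X (\<sigma> i) + X (\<sigma> j)) / (X (\<sigma> i) - X (\<sigma> j)))"
    if "i < length ls" for i
    using inner[OF that, of "\<lambda>j. (X (\<sigma> i) + X (\<sigma> j)) / (X (\<sigma> i) - X (\<sigma> j))"]
    by (simp add: fix_low that)
  then show ?thesis
    by (simp add: schur_Q_term_def fix_low)
qed

definition schur_Q_fract :: "nat \<Rightarrow> nat list \<Rightarrow> cpoly fract" where
  "schur_Q_fract N ls =
     2 ^ length ls * (\<Sum>C\<in>perm_cosets N (length ls). schur_Q_term N ls (SOME \<sigma>. \<sigma> \<in> C))"

text \<open>
  The Schur \<open>Q\<close>-polynomial in \<open>N\<close> variables, for \<open>length ls \<le> N\<close>: the polynomial that equals
  the rational function above in the fraction field.  Working with the polynomial matters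
  when it is evaluated at points with repeated coordinates.
\<close>

definition schur_Q :: "nat \<Rightarrow> nat list \<Rightarrow> cpoly" where
  "schur_Q N ls = (THE p. Fract p 1 = schur_Q_fract N ls)"

end

theory Submission
  imports Defs
begin

text \<open>
  Write \<open>K(u, v) = (v - u) / (u + v)\<close>, let \<open>V\<close> be the set of variables and put
  \<open>A(v) = \<Prod>\<^bsub>u \<noteq> v\<^esub> (v + u) / (v - u)\<close>, the product over all other variables.  The summand of
  the \<open>Q\<close>-polynomial attached to the variables \<open>v\<^sub>1, \<dots>, v\<^sub>m\<close> is
  \<open>\<Prod>\<^sub>i 2 v\<^sub>i\<^bsup>\<lambda>\<^sub>i\<^esup> A(v\<^sub>i)\<close> times \<open>\<Prod>\<^bsub>i<j\<^esub> K(v\<^sub>i, v\<^sub>j)\<close>: the product of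
  the \<open>A(v\<^sub>i)\<close> contains two factors for every pair of chosen variables where one is wanted, and
  \<open>K\<close> removes the other.  Since \<open>K(v, v) = 0\<close>, the sum may be extended to all lists of \<open>m\<close>
  variables, so the variables are independent apart from the kernel product.

  Schur's Pfaffian expansion writes \<open>\<Prod>\<^bsub>i<j\<^esub> K(v\<^sub>i, v\<^sub>j)\<close> as a signed sum over \<open>k\<close> of
  \<open>K(v\<^sub>1, v\<^sub>k)\<close> times the kernel product of the remaining variables, plus the kernel product of
  \<open>v\<^sub>2, \<dots>, v\<^sub>m\<close> if \<open>m\<close> is odd; it comes from the partial fraction expansion of \<open>\<Prod>\<^sub>v K(y, v)\<close> in \<open>y\<close> (lemma \<open>kernel_prod_Cons_expansion\<close>).  Summing over
  independent variables turns it into the same expansion of \<open>Q\<^sub>\<lambda>\<close> in terms of the functions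
  for one and two parts (lemma \<open>weighted_sum_kernel_prod\<close>).  The one-part functions satisfy a
  recursion in the set of variables, with generating function
  \<open>\<Prod>\<^sub>x (1 + x t) / (1 - x t)\<close>.  The two-part functions reduce to them by
  \<open>Q\<^bsub>(a, b+1)\<^esub> + Q\<^bsub>(a+1, b)\<^esub> = Q\<^sub>a Q\<^bsub>b+1\<^esub> - Q\<^bsub>a+1\<^esub> Q\<^sub>b\<close>,
  which holds because \<open>u + v\<close> cancels the denominator of \<open>K(u, v)\<close>.

  All these recursions are free of division.  They therefore define an element
  \<open>recursive_Q\<close> of any commutative ring, compatibly with ring homomorphisms.  In the ring of
  polynomials this element is the \<open>Q\<close>-polynomial, which shows that the rational function is
  a polynomial; its value at a point satisfies the same recursions, also where coordinates
  coincide, as they do for \<open>q = 0\<close>.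

  At \<open>1, q, q\<^sup>2, \<dots>\<close> the recursion for one part becomes an affine recurrence in the number of
  variables with contraction factor \<open>q\<^sup>a\<close>, whose limit is
  \<open>(-1; q)\<^sub>a / (q; q)\<^sub>a\<close>.  Limits for two parts follow by induction on the second
  part, and limits for \<open>m\<close> parts by the Pfaffian expansion.  The limit of the Pfaffian is
  a product because \<open>(q\<^sup>b - q\<^sup>a) / (1 - q\<^bsup>a+b\<^esup>)\<close> is again of the form \<open>K(u\<^sub>a, u\<^sub>b)\<close>, for
  \<open>u\<^sub>a = (1 + q\<^sup>a) / (1 - q\<^sup>a)\<close>, so that Schur's expansion can be read backwards.
\<close>

section \<open>Lists with one entry removed\<close>

definition remove_nth :: "nat \<Rightarrow> 'a list \<Rightarrow> 'a list" where
  "remove_nth k xs = take k xs @ drop (Suc k) xs"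

lemma remove_nth_append [simp]: "remove_nth (length as) (as @ v # bs) = as @ bs"
  by (simp add: remove_nth_def)

lemma length_remove_nth: "k < length xs \<Longrightarrow> length (remove_nth k xs) = length xs - 1"
  by (simp add: remove_nth_def)

lemma set_remove_nth_subset: "set (remove_nth k xs) \<subseteq> set xs"
  by (auto simp: remove_nth_def dest: in_set_takeD in_set_dropD)

lemma remove_nth_0 [simp]: "remove_nth 0 (x # xs) = xs"
  by (simp add: remove_nth_def)

lemma remove_nth_Suc [simp]: "remove_nth (Suc k) (x # xs) = x # remove_nth k xs"
  by (simp add: remove_nth_def)

lemma prod_list_remove_nth:
  fixes f :: "'b \<Rightarrow> 'r::comm_ring_1"
  assumes "k < length xs"
  shows "(\<Prod>x\<leftarrow>xs. f x) = f (xs ! k) * (\<Prod>x\<leftarrow>remove_nth k xs. f x)"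
  using assms
proof (induction xs arbitrary: k)
  case (Cons x xs)
  then show ?case by (cases k) (simp_all add: mult.left_commute)
qed simp

section \<open>The kernel \<open>(v - u) / (u + v)\<close> and its Pfaffian expansion\<close>

definition kernel :: "'a::field \<Rightarrow> 'a \<Rightarrow> 'a" where
  "kernel u v = (v - u) / (u + v)"

lemma kernel_swap: "kernel u v = - kernel v u"
  using minus_divide_left[of "u - v" "u + v"] by (simp add: kernel_def add.commute)

fun kernel_prod :: "'a::field list \<Rightarrow> 'a" where
  "kernel_prod [] = 1"
| "kernel_prod (u # us) = (\<Prod>v\<leftarrow>us. kernel u v) * kernel_prod us"

text \<open>
  Moving \<open>v\<close> past each entry of \<open>as\<close> reverses the arguments of one skew-symmetric factor.
\<close>

lemma kernel_prod_move_to_front: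
  "kernel_prod (as @ v # bs) = (-1) ^ length as * kernel_prod (v # as @ bs)"
proof (induction as)
  case (Cons a as)
  then show ?case by (simp add: kernel_swap[of a v])
qed simp

text \<open>
  As a function of \<open>y\<close>, the product of \<open>kernel y v\<close> over \<open>v \<in> V\<close> has a simple pole at
  \<open>- v\<close> for each \<open>v\<close>; up to the factor \<open>2 * v\<close>, this is its residue there.  The values of the
  other factors at \<open>y = - v\<close> are the factors of this product.
\<close>

definition reflected_coeff :: "'a::field set \<Rightarrow> 'a \<Rightarrow> 'a" where
  "reflected_coeff V v = (\<Prod>u\<in>V - {v}. (u + v) / (u - v))"

lemma reflected_coeff_insert:
  assumes "finite V" "a \<notin> V" "v \<in> V"
  shows "reflected_coeff (insert a V) v = reflected_coeff V v * ((a + v) / (a - v))"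
proof -
  have "insert a V - {v} = insert a (V - {v})" using assms by auto
  then show ?thesis using assms by (simp add: reflected_coeff_def mult.commute)
qed

text \<open>
  Induction on \<open>V\<close>.  The coefficient belonging to a new element \<open>a\<close> is the value at \<open>y = - a\<close> of
  the product over the old set, so the induction hypothesis, used at \<open>y\<close> and at \<open>- a\<close>, reduces
  the identity to a comparison of the summands for each \<open>v\<close>.
\<close>

lemma prod_kernel_partial_fractions:
  fixes y :: "'a::field"
  assumes "finite V" "\<And>v. v \<in> V \<Longrightarrow> y + v \<noteq> 0"
  shows "(\<Prod>v\<in>V. kernel y v) = (-1) ^ card V + (\<Sum>v\<in>V. reflected_coeff V v * (2 * v / (y + v)))"
  using assms
proof (induction V arbitrary: y rule: finite_induct)
  case (insert a V)
  have ya: "y + a \<noteq> 0" using insert.prems by simp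
  have IH: "(\<Prod>v\<in>V. kernel y v) = (-1) ^ card V + (\<Sum>v\<in>V. reflected_coeff V v * (2 * v / (y + v)))"
    using insert.IH[of y] insert.prems by simp
  have "reflected_coeff (insert a V) a = (\<Prod>v\<in>V. kernel (-a) v)"
    using insert.hyps by (simp add: reflected_coeff_def kernel_def)
  also have "\<dots> = (-1) ^ card V + (\<Sum>v\<in>V. reflected_coeff V v * (2 * v / (- a + v)))"
  proof (rule insert.IH)
    fix v assume "v \<in> V"
    with insert.hyps have "v \<noteq> a" by auto
    then show "- a + v \<noteq> 0" by (simp add: add_eq_0_iff)
  qed
  finally have reflected_coeff_a: "reflected_coeff (insert a V) a = (-1) ^ card V + (\<Sum>v\<in>V. reflected_coeff V v * (2 * v / (- a + v)))" .
  have const: "(-1) ^ card V * kernel y a = - ((-1) ^ card V) + (-1) ^ card V * (2 * a / (y + a))"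
  proof -
    have "kernel y a = -1 + 2 * a / (y + a)"
      using ya by (simp add: kernel_def field_simps)
    then show ?thesis by (simp only: distrib_left) simp
  qed
  have termwise: "reflected_coeff V v * (2 * v / (y + v)) * kernel y a =
      reflected_coeff (insert a V) v * (2 * v / (y + v)) + reflected_coeff V v * (2 * v / (- a + v)) * (2 * a / (y + a))"
    if "v \<in> V" for v
  proof -
    have nz: "y + v \<noteq> 0" "a - v \<noteq> 0" "- a + v \<noteq> 0"
      using that insert.prems[of v] insert.hyps by (auto simp: add_eq_0_iff)
    have m: "2 * v / (- a + v) = - (2 * v / (a - v))"
      using nz by (simp add: field_simps)
    have "2 * v / (y + v) * kernel y a =
       (a + v) / (a - v) * (2 * v / (y + v)) + 2 * v / (- a + v) * (2 * a / (y + a))"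
      using nz ya unfolding kernel_def m by (simp add: divide_simps) (simp add: algebra_simps)
    then have "reflected_coeff V v * (2 * v / (y + v) * kernel y a) = reflected_coeff V v *
       ((a + v) / (a - v) * (2 * v / (y + v)) + 2 * v / (- a + v) * (2 * a / (y + a)))" by simp
    then show ?thesis
      by (simp only: reflected_coeff_insert[OF insert.hyps that] distrib_left mult.assoc)
  qed
  have sums: "(\<Sum>v\<in>V. reflected_coeff V v * (2 * v / (y + v)) * kernel y a) =
      (\<Sum>v\<in>V. reflected_coeff (insert a V) v * (2 * v / (y + v))) +
      (\<Sum>v\<in>V. reflected_coeff V v * (2 * v / (- a + v))) * (2 * a / (y + a))"
    by (simp only: sum_distrib_right sum.distrib[symmetric] termwise cong: sum.cong)
  have "(\<Prod>v\<in>insert a V. kernel y v) =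
     (-1) ^ card V * kernel y a + (\<Sum>v\<in>V. reflected_coeff V v * (2 * v / (y + v)) * kernel y a)"
    by (simp only: prod.insert[OF insert.hyps] IH distrib_left sum_distrib_left) (simp only: mult_ac)
  also have "\<dots> = - ((-1) ^ card V) + (\<Sum>v\<in>V. reflected_coeff (insert a V) v * (2 * v / (y + v)))
       + reflected_coeff (insert a V) a * (2 * a / (y + a))"
    unfolding const reflected_coeff_a sums by (simp only: distrib_right) (simp only: add_ac)
  finally show ?case using insert.hyps by (simp add: add_ac)
qed simp

text \<open>
  The partial fraction expansion at \<open>y = 0\<close>, where the product and all fractions are constant.
\<close>

lemma sum_reflected_coeff:
  fixes V :: "'a::field set"
  assumes "finite V" "\<And>v. v \<in> V \<Longrightarrow> v + v \<noteq> 0"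
  shows "(\<Sum>v\<in>V. reflected_coeff V v) = (if odd (card V) then 1 else 0)"
proof (cases "V = {}")
  case False
  then obtain v where "v \<in> V" by auto
  then have "2 * v \<noteq> 0" using assms(2)[of v] by simp
  then have two: "(2::'a) \<noteq> 0" by auto
  have nz: "v \<noteq> 0" if "v \<in> V" for v using assms(2)[OF that] by auto
  have "1 = (\<Prod>v\<in>V. kernel 0 v)" using nz by (simp add: kernel_def)
  also have "\<dots> = (-1) ^ card V + (\<Sum>v\<in>V. reflected_coeff V v * (2 * v / (0 + v)))"
    using assms nz by (intro prod_kernel_partial_fractions) auto
  also have "(\<Sum>v\<in>V. reflected_coeff V v * (2 * v / (0 + v))) = 2 * (\<Sum>v\<in>V. reflected_coeff V v)"
    using nz by (simp add: sum_distrib_left mult.commute)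
  finally show ?thesis using two by (cases "even (card V)") simp_all
qed simp

text \<open>
  The partial fraction expansion rewritten by \<open>2 * v / (y + v) = 1 + kernel y v\<close>.  Both parities
  are covered: the constant term is what makes the odd Pfaffian expansions differ from the
  even ones.
\<close>

lemma prod_kernel_expansion:
  fixes y :: "'a::field"
  assumes "finite V" "\<And>v. v \<in> V \<Longrightarrow> v + v \<noteq> 0" "\<And>v. v \<in> V \<Longrightarrow> y + v \<noteq> 0"
  shows "(\<Prod>v\<in>V. kernel y v) =
    (if even (card V) then 1 else 0) + (\<Sum>v\<in>V. reflected_coeff V v * kernel y v)"
proof -
  have "2 * v / (y + v) = 1 + kernel y v" if "v \<in> V" for v
    using assms(3)[OF that] by (simp add: kernel_def field_simps)
  then have "(\<Sum>v\<in>V. reflected_coeff V v * (2 * v / (y + v))) =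
      (\<Sum>v\<in>V. reflected_coeff V v) + (\<Sum>v\<in>V. reflected_coeff V v * kernel y v)"
    by (simp add: distrib_left sum.distrib)
  then show ?thesis
    using prod_kernel_partial_fractions[of V y] assms by (simp add: sum_reflected_coeff)
qed

lemma kernel_prod_split_nth:
  assumes "k < length us"
  shows "kernel_prod us =
    (-1) ^ k * (\<Prod>v\<leftarrow>remove_nth k us. kernel (us ! k) v) * kernel_prod (remove_nth k us)"
  using kernel_prod_move_to_front[of "take k us" "us ! k" "drop (Suc k) us"] assms
  by (simp add: remove_nth_def id_take_nth_drop[symmetric])

lemma kernel_prod_not_distinct:
  assumes "\<not> distinct us"
  shows "kernel_prod us = 0"
proof -
  obtain as v bs cs where us: "us = as @ v # bs @ v # cs"
    using not_distinct_decomp[OF assms] by auto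
  show ?thesis unfolding us kernel_prod_move_to_front[of as] by (simp add: kernel_def)
qed

text \<open>
  Schur's expansion of the kernel product along its first entry.  If the entries of \<open>us\<close> are
  distinct, it is the expansion of the product of \<open>kernel y v\<close> multiplied by \<open>kernel_prod us\<close>.
  If a value \<open>v\<close> occurs twice, the coefficients have no meaning, but then all terms vanish
  except the two that remove an occurrence of \<open>v\<close>, and these cancel.
\<close>

lemma kernel_prod_Cons_expansion:
  fixes us :: "'a::field list"
  assumes sums: "\<And>u v. u \<in> set (y # us) \<Longrightarrow> v \<in> set (y # us) \<Longrightarrow> u + v \<noteq> 0"
  shows "kernel_prod (y # us) = (if even (length us) then kernel_prod us else 0) +
    (\<Sum>k<length us. (-1) ^ k * kernel y (us ! k) * kernel_prod (remove_nth k us))"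
proof (cases "distinct us")
  case True
  \<comment> \<open>Multiplying by the coefficient of \<open>us ! k\<close> deletes this entry from the kernel product.\<close>
  have factor: "(-1) ^ k * kernel_prod (remove_nth k us) = reflected_coeff (set us) (us ! k) * kernel_prod us"
    if k: "k < length us" for k
  proof -
    define ws where "ws = remove_nth k us"
    have us: "us = take k us @ us ! k # drop (Suc k) us" using k by (rule id_take_nth_drop)
    have "distinct (take k us @ us ! k # drop (Suc k) us)" using True us by simp
    then have ws: "distinct ws" "set ws = set us - {us ! k}"
      using arg_cong[OF us, of set] by (auto simp: ws_def remove_nth_def)
    \<comment> \<open>The coefficient is the inverse of the kernel factors that involve \<open>us ! k\<close>.\<close>
    have "reflected_coeff (set us) (us ! k) * (\<Prod>v\<leftarrow>ws. kernel (us ! k) v) =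
      (\<Prod>v\<in>set us - {us ! k}. (v + us ! k) / (v - us ! k) * kernel (us ! k) v)"
      using ws by (simp add: reflected_coeff_def prod.distinct_set_conv_list[symmetric] flip: prod.distrib)
    also have "\<dots> = (\<Prod>v\<in>set us - {us ! k}. 1)"
    proof (rule prod.cong)
      fix v assume "v \<in> set us - {us ! k}"
      then have "us ! k + v \<noteq> 0" "v - us ! k \<noteq> 0" using sums[of "us ! k" v] k by auto
      then show "(v + us ! k) / (v - us ! k) * kernel (us ! k) v = 1"
        by (simp add: kernel_def add.commute)
    qed simp
    finally have inv: "reflected_coeff (set us) (us ! k) * (\<Prod>v\<leftarrow>ws. kernel (us ! k) v) = 1" by simp
    have "reflected_coeff (set us) (us ! k) * kernel_prod us =
       (-1) ^ k * (reflected_coeff (set us) (us ! k) * (\<Prod>v\<leftarrow>ws. kernel (us ! k) v)) * kernel_prod ws"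
      unfolding kernel_prod_split_nth[OF k] ws_def by (simp only: mult_ac)
    also have "\<dots> = (-1) ^ k * kernel_prod ws" by (simp only: inv mult_1_right)
    finally show ?thesis by (simp only: ws_def)
  qed
  have "kernel_prod (y # us) = (\<Prod>v\<in>set us. kernel y v) * kernel_prod us"
    using True by (simp add: prod.distinct_set_conv_list)
  also have "(\<Prod>v\<in>set us. kernel y v) =
      (if even (length us) then 1 else 0) + (\<Sum>v\<in>set us. reflected_coeff (set us) v * kernel y v)"
    unfolding distinct_card[OF True, symmetric]
    by (rule prod_kernel_expansion) (simp, (rule sums; simp)+)
  also have "(\<Sum>v\<in>set us. reflected_coeff (set us) v * kernel y v) =
      (\<Sum>k<length us. reflected_coeff (set us) (us ! k) * kernel y (us ! k))"
    using sum.reindex_bij_betw[OF bij_betw_nth[OF True refl refl],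
        of "\<lambda>v. reflected_coeff (set us) v * kernel y v"] by simp
  also have "((if even (length us) then 1 else 0) + \<dots>) * kernel_prod us =
      (if even (length us) then kernel_prod us else 0) +
      (\<Sum>k<length us. kernel y (us ! k) * (reflected_coeff (set us) (us ! k) * kernel_prod us))"
    by (simp add: distrib_left distrib_right sum_distrib_left sum_distrib_right mult_ac)
  also have "(\<Sum>k<length us. kernel y (us ! k) * (reflected_coeff (set us) (us ! k) * kernel_prod us)) =
      (\<Sum>k<length us. (-1) ^ k * kernel y (us ! k) * kernel_prod (remove_nth k us))"
  proof (intro sum.cong refl)
    fix k assume "k \<in> {..<length us}"
    then have "k < length us" by simp
    from factor[OF this, symmetric]
    show "kernel y (us ! k) * (reflected_coeff (set us) (us ! k) * kernel_prod us) =
        (-1) ^ k * kernel y (us ! k) * kernel_prod (remove_nth k us)"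
      by (simp only: mult_ac)
  qed
  finally show ?thesis .
next
  case False
  then obtain as v bs cs where us: "us = as @ v # bs @ v # cs"
    using not_distinct_decomp by fastforce
  define i where "i = length as"
  define j where "j = length (as @ v # bs)"
  have rem_i: "remove_nth i us = as @ bs @ v # cs" unfolding us i_def by simp
  have rem_j: "remove_nth j us = as @ v # bs @ cs" unfolding us j_def
    using remove_nth_append[of "as @ v # bs" v cs] by simp
  have ij: "us ! i = v" "us ! j = v" "i < j" "j < length us"
    by (simp_all add: us i_def j_def nth_append)
  let ?t = "\<lambda>k. (-1) ^ k * kernel y (us ! k) * kernel_prod (remove_nth k us)"
  \<comment> \<open>Removing any other position leaves both occurrences of \<open>v\<close> in place.\<close>
  have zero: "?t k = 0" if k: "k \<in> {..<length us} - {i, j}" for k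
  proof -
    have "\<not> distinct (remove_nth k us)"
    proof -
      consider "k < i" | "i < k" "k < j" | "j < k" using k ij by force
      then show ?thesis
      proof cases
        case 1
        then obtain d where "i = Suc (k + d)" using less_iff_Suc_add by auto
        then show ?thesis unfolding remove_nth_def using 1 by (simp add: us i_def)
      next
        case 2
        then have "v \<in> set (take k us)" "v \<in> set (drop (Suc k) us)"
          using ij nth_mem[of i "take k us"] nth_mem[of "j - Suc k" "drop (Suc k) us"] by auto
        then show ?thesis by (auto simp: remove_nth_def)
      next
        case 3
        then have "\<not> distinct (take k us)"
          using ij nth_eq_iff_index_eq[of "take k us" i j] by auto
        then show ?thesis by (simp add: remove_nth_def)
      qed
    qed
    then show ?thesis by (simp add: kernel_prod_not_distinct)
  qed
  have "(\<Sum>k<length us. ?t k) = (\<Sum>k\<in>{i, j}. ?t k)"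
    using zero ij by (intro sum.mono_neutral_right) auto
  also have "\<dots> = kernel y v *
      ((-1) ^ i * kernel_prod (as @ bs @ v # cs) + (-1) ^ j * kernel_prod (as @ v # bs @ cs))"
    using ij by (simp add: rem_i rem_j algebra_simps)
  also have "\<dots> = 0"
    using kernel_prod_move_to_front[of "as @ bs" v cs] kernel_prod_move_to_front[of as v "bs @ cs"]
    by (simp add: i_def j_def power_add)
  finally have sum0: "(\<Sum>k<length us. ?t k) = 0" .
  have "kernel_prod us = 0" using False by (rule kernel_prod_not_distinct)
  then show ?thesis using sum0 by simp
qed

lemma kernel_prod_conv_prod:
  "kernel_prod vs = (\<Prod>i<length vs. \<Prod>j<i. kernel (vs ! j) (vs ! i))"
proof (induction vs)
  case (Cons u us)
  have "(\<Prod>v\<leftarrow>us. kernel u v) = (\<Prod>i<length us. kernel u (us ! i))"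
    by (simp add: prod.list_conv_set_nth atLeast0LessThan)
  then show ?case
    by (simp add: Cons.IH prod.lessThan_Suc_shift o_def prod.distrib del: prod.lessThan_Suc)
qed simp

section \<open>Pfaffian expansions over a commutative ring\<close>

text \<open>
  The expansion along the first row of the Pfaffian of the skew-symmetric matrix with entries
  \<open>p a b\<close>; for an odd number of indices the matrix is bordered by a last column with entries
  \<open>h a\<close>.  Taking the expansion as the definition keeps it free of division and meaningful for
  every \<open>p\<close>.
\<close>

function pfaffian :: "(nat \<Rightarrow> 'r::comm_ring_1) \<Rightarrow> (nat \<Rightarrow> nat \<Rightarrow> 'r) \<Rightarrow> nat list \<Rightarrow> 'r" where
  "pfaffian h p [] = 1"
| "pfaffian h p (l # ls) = (if even (length ls) then h l * pfaffian h p ls else 0) +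
     (\<Sum>k<length ls. (-1) ^ k * p l (ls ! k) * pfaffian h p (remove_nth k ls))"
  by pat_completeness auto
termination
  by (relation "Wellfounded.measure (\<lambda>(_, _, ls). length ls)") (auto simp: length_remove_nth)

lemma pfaffian_cong:
  assumes "\<And>a. a \<in> set ls \<Longrightarrow> h a = h' a"
    and "\<And>a b. a \<in> set ls \<Longrightarrow> b \<in> set ls \<Longrightarrow> p a b = p' a b"
  shows "pfaffian h p ls = pfaffian h' p' ls"
  using assms
proof (induction ls rule: length_induct)
  case (1 ls)
  show ?case
  proof (cases ls)
    case (Cons l ks)
    have ks: "pfaffian h p ks = pfaffian h' p' ks"
      using 1 by (simp add: Cons)
    have rem: "pfaffian h p (remove_nth k ks) = pfaffian h' p' (remove_nth k ks)"
      if "k < length ks" for k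
      using 1 that set_remove_nth_subset[of k ks] by (auto simp: Cons length_remove_nth subset_iff)
    have "p l (ks ! k) = p' l (ks ! k)" if "k < length ks" for k
      using 1(3) that by (simp add: Cons)
    with ks rem 1(2) show ?thesis by (simp add: Cons)
  qed simp
qed

text \<open>
  Schur's expansion read backwards.  Each row and column index \<open>a\<close> contributes one factor
  \<open>h a\<close> to every term of the Pfaffian.
\<close>

lemma pfaffian_kernel:
  fixes u h :: "nat \<Rightarrow> 'a::field"
  assumes "\<And>a b. a \<in> set ls \<Longrightarrow> b \<in> set ls \<Longrightarrow> u a + u b \<noteq> 0"
  shows "pfaffian h (\<lambda>a b. h a * h b * kernel (u a) (u b)) ls =
    (\<Prod>l\<leftarrow>ls. h l) * kernel_prod (map u ls)"
    (is "pfaffian h ?p ls = _")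
  using assms
proof (induction ls rule: length_induct)
  case (1 ls)
  show ?case
  proof (cases ls)
    case (Cons l ks)
    let ?H = "\<lambda>js. \<Prod>l\<leftarrow>js. h l" and ?K = "\<lambda>js. kernel_prod (map u js)"
    have IH: "pfaffian h ?p js = ?H js * ?K js" if "length js < length ls" "set js \<subseteq> set ls" for js
      using 1 that by blast
    have map_rem: "map u (remove_nth k ks) = remove_nth k (map u ks)" for k
      by (simp add: remove_nth_def take_map drop_map)
    have sums: "x + y \<noteq> 0" if "x \<in> set (u l # map u ks)" "y \<in> set (u l # map u ks)" for x y
      using that 1(2) unfolding Cons by auto
    have summand: "(-1) ^ k * ?p l (ks ! k) * pfaffian h ?p (remove_nth k ks) =
       ?H ls * ((-1) ^ k * kernel (u l) (map u ks ! k) * kernel_prod (remove_nth k (map u ks)))"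
      if "k < length ks" for k
      using that set_remove_nth_subset[of k ks]
      by (subst IH) (auto simp: Cons length_remove_nth map_rem[symmetric] prod_list_remove_nth[OF that])
    have "pfaffian h ?p ls = (if even (length ks) then ?H ls * ?K ks else 0) +
       (\<Sum>k<length ks. ?H ls * ((-1) ^ k * kernel (u l) (map u ks ! k) * kernel_prod (remove_nth k (map u ks))))"
      unfolding Cons pfaffian.simps
      by (intro arg_cong2[where f = "(+)"] sum.cong refl summand[unfolded Cons])
        (use IH[of ks] in \<open>auto simp: Cons mult.assoc\<close>)
    also have "\<dots> = ?H ls * ((if even (length ks) then ?K ks else 0) +
       (\<Sum>k<length ks. (-1) ^ k * kernel (u l) (map u ks ! k) * kernel_prod (remove_nth k (map u ks))))"
      by (simp add: sum_distrib_left distrib_left)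
    also have "\<dots> = ?H ls * ?K ls"
      using kernel_prod_Cons_expansion[of "u l" "map u ks", OF sums] by (simp add: Cons)
    finally show ?thesis .
  qed simp
qed

lemma tendsto_pfaffian:
  fixes h :: "nat \<Rightarrow> nat \<Rightarrow> 'r::real_normed_field"
  assumes "\<And>a. a \<in> set ls \<Longrightarrow> (\<lambda>n. h n a) \<longlonglongrightarrow> h' a"
    and "\<And>a b. a \<in> set ls \<Longrightarrow> b \<in> set ls \<Longrightarrow> (\<lambda>n. p n a b) \<longlonglongrightarrow> p' a b"
  shows "(\<lambda>n. pfaffian (h n) (p n) ls) \<longlonglongrightarrow> pfaffian h' p' ls"
  using assms
proof (induction ls rule: length_induct)
  case (1 ls)
  show ?case
  proof (cases ls)
    case (Cons l ks)
    have IH: "(\<lambda>n. pfaffian (h n) (p n) js) \<longlonglongrightarrow> pfaffian h' p' js"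
      if "length js < length ls" "set js \<subseteq> set ls" for js
      using 1 that by blast
    have "(\<lambda>n. (-1) ^ k * p n l (ks ! k) * pfaffian (h n) (p n) (remove_nth k ks))
        \<longlonglongrightarrow> (-1) ^ k * p' l (ks ! k) * pfaffian h' p' (remove_nth k ks)" if "k < length ks" for k
      using that set_remove_nth_subset[of k ks]
      by (intro tendsto_mult tendsto_const IH 1(3)) (auto simp: Cons length_remove_nth)
    moreover have "(\<lambda>n. if even (length ks) then h n l * pfaffian (h n) (p n) ks else 0)
        \<longlonglongrightarrow> (if even (length ks) then h' l * pfaffian h' p' ks else 0)"
      using IH[of ks] 1(2)[of l] by (auto simp: Cons intro!: tendsto_mult)
    ultimately show ?thesis
      unfolding Cons pfaffian.simps by (intro tendsto_add tendsto_sum) auto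
  qed simp
qed

section \<open>Schur Q-functions by recursion\<close>

text \<open>
  The coefficient of \<open>t\<^sup>a\<close> in \<open>\<Prod>\<^sub>x (1 + x t) / (1 - x t)\<close>.  The recursion compares
  coefficients after multiplication by \<open>1 - x t\<close> for the first variable \<open>x\<close>.
\<close>

fun row_Q :: "'r::comm_ring_1 list \<Rightarrow> nat \<Rightarrow> 'r" where
  "row_Q [] a = (if a = 0 then 1 else 0)"
| "row_Q (x # xs) 0 = 1"
| "row_Q (x # xs) (Suc a) = row_Q xs (Suc a) + x * row_Q xs a + x * row_Q (x # xs) a"

lemma row_Q_0 [simp]: "row_Q xs 0 = 1"
  by (cases xs) simp_all

text \<open>
  The two-part function in terms of the one-part functions \<open>h\<close>.  The value at \<open>b = 0\<close> agrees
  with the convention that \<open>Q\<close> does not change when a part \<open>0\<close> is appended.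
\<close>

fun pair_Q :: "(nat \<Rightarrow> 'r::comm_ring_1) \<Rightarrow> nat \<Rightarrow> nat \<Rightarrow> 'r" where
  "pair_Q h a 0 = h a"
| "pair_Q h a (Suc b) = h a * h (Suc b) - h (Suc a) * h b - pair_Q h (Suc a) b"

definition recursive_Q :: "'r::comm_ring_1 list \<Rightarrow> nat list \<Rightarrow> 'r" where
  "recursive_Q xs = pfaffian (row_Q xs) (pair_Q (row_Q xs))"

text \<open>
  Two homomorphisms out of the polynomial ring matter: the embedding into its fraction field,
  where \<open>recursive_Q\<close> is compared with the symmetrization, and evaluation at a point.
\<close>

locale comm_ring_hom =
  fixes \<phi> :: "'r::comm_ring_1 \<Rightarrow> 's::comm_ring_1"
  assumes one: "\<phi> 1 = 1" and add: "\<phi> (a + b) = \<phi> a + \<phi> b" and mult: "\<phi> (a * b) = \<phi> a * \<phi> b"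
begin

lemma zero: "\<phi> 0 = 0"
  using add[of 0 0] by simp

lemma uminus: "\<phi> (- a) = - \<phi> a"
  using add[of a "- a"] zero by (simp add: eq_neg_iff_add_eq_0 add.commute)

lemma diff: "\<phi> (a - b) = \<phi> a - \<phi> b"
  using add[of a "- b"] by (simp add: uminus)

lemma neg_one_power: "\<phi> ((-1) ^ n) = (-1) ^ n"
  by (induction n) (simp_all add: one uminus mult)

lemma sum: "\<phi> (sum f K) = (\<Sum>k\<in>K. \<phi> (f k))"
  by (induction K rule: infinite_finite_induct) (simp_all add: zero add)

lemma row_Q: "\<phi> (row_Q xs a) = row_Q (map \<phi> xs) a"
  by (induction xs a rule: row_Q.induct) (simp_all add: zero one add mult)

lemma pair_Q: "\<phi> (pair_Q h a b) = pair_Q (\<lambda>a. \<phi> (h a)) a b"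
  by (induction b arbitrary: a) (simp_all add: diff mult)

lemma pfaffian: "\<phi> (pfaffian h p ls) = pfaffian (\<lambda>a. \<phi> (h a)) (\<lambda>a b. \<phi> (p a b)) ls"
proof (induction ls rule: length_induct)
  case (1 ls)
  show ?case
  proof (cases ls)
    case (Cons l ks)
    with 1 show ?thesis
      by (simp add: length_remove_nth add mult sum zero neg_one_power)
  qed (simp add: one)
qed

lemma recursive_Q: "\<phi> (recursive_Q xs ls) = recursive_Q (map \<phi> xs) ls"
  by (simp add: recursive_Q_def pfaffian row_Q[abs_def] pair_Q)

end

section \<open>Weighted sums of kernel products\<close>

text \<open>
  The sum of \<open>g\<close> over all lists of elements of \<open>V\<close>, each entry \<open>v\<close> being weighted according to
  the label \<open>l\<close> at its position.  The nested form suits induction on the labels; the form as a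
  single sum is \<open>weighted_sum_conv_sum_lists\<close>.
\<close>

fun weighted_sum :: "('l \<Rightarrow> 'a \<Rightarrow> 'b) \<Rightarrow> 'a set \<Rightarrow> 'l list \<Rightarrow> ('a list \<Rightarrow> 'b) \<Rightarrow> 'b::comm_ring_1" where
  "weighted_sum w V [] g = g []"
| "weighted_sum w V (l # ls) g = (\<Sum>v\<in>V. w l v * weighted_sum w V ls (\<lambda>vs. g (v # vs)))"

lemma weighted_sum_cong:
  assumes "\<And>vs. set vs \<subseteq> V \<Longrightarrow> length vs = length ls \<Longrightarrow> g vs = g' vs"
  shows "weighted_sum w V ls g = weighted_sum w V ls g'"
  using assms
proof (induction ls arbitrary: g g')
  case (Cons l ls)
  have "weighted_sum w V ls (\<lambda>vs. g (v # vs)) = weighted_sum w V ls (\<lambda>vs. g' (v # vs))"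
    if "v \<in> V" for v
    using that by (intro Cons.IH Cons.prems) auto
  then show ?case by simp
qed simp

lemma weighted_sum_0 [simp]: "weighted_sum w V ls (\<lambda>vs. 0) = 0"
  by (induction ls) simp_all

lemma weighted_sum_add:
  "weighted_sum w V ls (\<lambda>vs. g vs + g' vs) = weighted_sum w V ls g + weighted_sum w V ls g'"
  by (induction ls arbitrary: g g') (simp_all add: sum.distrib distrib_left)

lemma weighted_sum_cmult:
  "weighted_sum w V ls (\<lambda>vs. c * g vs) = c * weighted_sum w V ls g"
  by (induction ls arbitrary: g) (simp_all add: sum_distrib_left mult_ac)

lemma weighted_sum_sum:
  "finite K \<Longrightarrow> weighted_sum w V ls (\<lambda>vs. \<Sum>k\<in>K. g k vs) = (\<Sum>k\<in>K. weighted_sum w V ls (g k))"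
  by (induction K rule: finite_induct) (simp_all add: weighted_sum_add)

text \<open>
  The weights treat the positions independently.  In a term of Schur's expansion this separates
  the entry coupled to the first one from all others.
\<close>

lemma weighted_sum_factor_nth:
  assumes "k < length ls"
  shows "weighted_sum w V ls (\<lambda>vs. f (vs ! k) * g (remove_nth k vs)) =
    (\<Sum>v\<in>V. w (ls ! k) v * f v) * weighted_sum w V (remove_nth k ls) g"
  using assms
proof (induction ls arbitrary: k g)
  case (Cons l ls)
  show ?case
  proof (cases k)
    case 0
    then show ?thesis by (simp add: weighted_sum_cmult sum_distrib_left sum_distrib_right mult_ac)
  next
    case (Suc j)
    with Cons.prems have "j < length ls" by simp
    define S where "S = (\<Sum>v\<in>V. w (ls ! j) v * f v)"
    have "weighted_sum w V ls (\<lambda>vs. f (vs ! j) * g (v # remove_nth j vs)) =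
        S * weighted_sum w V (remove_nth j ls) (\<lambda>vs. g (v # vs))" for v
      unfolding S_def using \<open>j < length ls\<close> by (rule Cons.IH)
    then have "weighted_sum w V (l # ls) (\<lambda>vs. f (vs ! k) * g (remove_nth k vs)) =
        S * weighted_sum w V (remove_nth k (l # ls)) g"
      by (simp add: Suc sum_distrib_left mult.left_commute)
    then show ?thesis by (simp add: Suc S_def)
  qed
qed simp

lemma weighted_sum_conv_sum_lists:
  assumes "finite V"
  shows "weighted_sum w V ls g =
    (\<Sum>vs | set vs \<subseteq> V \<and> length vs = length ls. (\<Prod>i<length ls. w (ls ! i) (vs ! i)) * g vs)"
proof (induction ls arbitrary: g)
  case Nil
  have "{vs. set vs \<subseteq> V \<and> length vs = length []} = {[]}" by auto
  then show ?case by simp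
next
  case (Cons l ls)
  let ?L = "{vs. set vs \<subseteq> V \<and> length vs = length ls}"
  have lists: "{vs. set vs \<subseteq> V \<and> length vs = length (l # ls)} = (\<lambda>(v, vs). v # vs) ` (V \<times> ?L)"
    by (auto simp: length_Suc_conv image_iff)
  have inj: "inj_on (\<lambda>(v, vs). v # vs) (V \<times> ?L)" by (auto simp: inj_on_def)
  show ?case unfolding lists sum.reindex[OF inj]
    by (simp add: Cons.IH prod.lessThan_Suc_shift o_def sum_distrib_left mult.assoc
        sum.cartesian_product case_prod_unfold del: prod.lessThan_Suc)
qed

text \<open>
  Schur's expansion is applied under the sum.  In each of its terms the first entry is coupled
  to a single further entry, so the sum factors into a double sum and a shorter weighted sum.
\<close>

lemma weighted_sum_kernel_prod:
  fixes w :: "nat \<Rightarrow> 'a::field \<Rightarrow> 'a"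
  assumes sums: "\<And>u v. u \<in> V \<Longrightarrow> v \<in> V \<Longrightarrow> u + v \<noteq> 0"
  shows "weighted_sum w V ls kernel_prod =
    pfaffian (\<lambda>a. \<Sum>v\<in>V. w a v) (\<lambda>a b. \<Sum>u\<in>V. w a u * (\<Sum>v\<in>V. w b v * kernel u v)) ls"
    (is "_ = pfaffian ?h ?p ls")
proof (induction ls rule: length_induct)
  case (1 ls)
  show ?case
  proof (cases ls)
    case (Cons l ks)
    let ?W = "weighted_sum w V"
    have expand: "?W ks (\<lambda>vs. kernel_prod (y # vs)) =
       (if even (length ks) then ?W ks kernel_prod else 0) +
       (\<Sum>k<length ks. (-1) ^ k * ((\<Sum>v\<in>V. w (ks ! k) v * kernel y v) * ?W (remove_nth k ks) kernel_prod))"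
      if y: "y \<in> V" for y
    proof -
      have "?W ks (\<lambda>vs. kernel_prod (y # vs)) =
        ?W ks (\<lambda>vs. (if even (length ks) then 1 else 0) * kernel_prod vs +
          (\<Sum>k<length ks. (-1) ^ k * (kernel y (vs ! k) * kernel_prod (remove_nth k vs))))"
      proof (rule weighted_sum_cong)
        fix vs assume vs: "set vs \<subseteq> V" "length vs = length ks"
        have "u + v \<noteq> 0" if "u \<in> set (y # vs)" "v \<in> set (y # vs)" for u v
          using that vs y by (intro sums) auto
        from kernel_prod_Cons_expansion[of y vs, OF this]
        show "kernel_prod (y # vs) = (if even (length ks) then 1 else 0) * kernel_prod vs +
          (\<Sum>k<length ks. (-1) ^ k * (kernel y (vs ! k) * kernel_prod (remove_nth k vs)))"
          using vs by (simp add: mult.assoc)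
      qed
      also have "\<dots> = (if even (length ks) then 1 else 0) * ?W ks kernel_prod +
          (\<Sum>k<length ks. (-1) ^ k * ?W ks (\<lambda>vs. kernel y (vs ! k) * kernel_prod (remove_nth k vs)))"
        by (simp only: weighted_sum_add weighted_sum_cmult weighted_sum_sum[OF finite_lessThan])
      finally show ?thesis by (simp add: weighted_sum_factor_nth)
    qed
    have "?W ls kernel_prod = (\<Sum>y\<in>V. w l y * ((if even (length ks) then ?W ks kernel_prod else 0) +
       (\<Sum>k<length ks. (-1) ^ k * ((\<Sum>v\<in>V. w (ks ! k) v * kernel y v) * ?W (remove_nth k ks) kernel_prod))))"
      unfolding Cons weighted_sum.simps by (intro sum.cong refl arg_cong2[where f = "(*)"] expand)
    also have "\<dots> = (if even (length ks) then ?h l * ?W ks kernel_prod else 0) +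
       (\<Sum>k<length ks. \<Sum>y\<in>V. (-1) ^ k * (w l y * (\<Sum>v\<in>V. w (ks ! k) v * kernel y v)) * ?W (remove_nth k ks) kernel_prod)"
      unfolding distrib_left sum.distrib sum_distrib_left[of _ _ "{..<length ks}"]
      by (subst sum.swap[of _ _ V]) (simp add: sum_distrib_right mult_ac)
    also have "\<dots> = (if even (length ks) then ?h l * ?W ks kernel_prod else 0) +
       (\<Sum>k<length ks. (-1) ^ k * ?p l (ks ! k) * ?W (remove_nth k ks) kernel_prod)"
      by (simp only: sum_distrib_left sum_distrib_right)
    also have "\<dots> = pfaffian ?h ?p ls"
      using 1 by (simp add: Cons length_remove_nth)
    finally show ?thesis .
  qed simp
qed

section \<open>One-part and two-part sums\<close>

text \<open>
  The product \<open>A(v)\<close> of the introduction.  It differs from \<open>reflected_coeff\<close> in the sign of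
  each factor.
\<close>

definition pole_coeff :: "'a::field set \<Rightarrow> 'a \<Rightarrow> 'a" where
  "pole_coeff V v = (\<Prod>u\<in>V - {v}. (v + u) / (v - u))"

lemma pole_coeff_insert:
  assumes "finite V" "a \<notin> V" "v \<in> V"
  shows "pole_coeff (insert a V) v = pole_coeff V v * ((v + a) / (v - a))"
proof -
  have "insert a V - {v} = insert a (V - {v})" using assms by auto
  then show ?thesis using assms by (simp add: pole_coeff_def mult.commute)
qed

lemma pole_coeff_conv_reflected_coeff:
  fixes V :: "'a::field set"
  assumes "finite V" "v \<in> V"
  shows "pole_coeff V v = - ((-1) ^ card V) * reflected_coeff V v"
proof -
  have flip: "(v + u) / (v - u) = - ((u + v) / (u - v))" for u
    by (simp only: minus_divide_right minus_diff_eq add.commute)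
  have sign: "(-1) ^ card (V - {v}) = - ((-1) ^ card V :: 'a)"
    unfolding card.remove[OF assms] by simp
  have "pole_coeff V v = (\<Prod>u\<in>V - {v}. - ((u + v) / (u - v)))"
    unfolding pole_coeff_def by (intro prod.cong refl flip)
  also have "\<dots> = (-1) ^ card (V - {v}) * reflected_coeff V v"
    unfolding reflected_coeff_def by (rule prod_uminus)
  finally show ?thesis unfolding sign .
qed

definition weight :: "'a::field set \<Rightarrow> nat \<Rightarrow> 'a \<Rightarrow> 'a" where
  "weight V a v = 2 * v ^ a * pole_coeff V v"

definition moment1 :: "'a::field set \<Rightarrow> nat \<Rightarrow> 'a" where
  "moment1 V a = (\<Sum>v\<in>V. weight V a v)"

definition moment2 :: "'a::field set \<Rightarrow> nat \<Rightarrow> nat \<Rightarrow> 'a" where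
  "moment2 V a b = (\<Sum>u\<in>V. weight V a u * (\<Sum>v\<in>V. weight V b v * kernel u v))"

lemma moment1_0:
  assumes "finite V" "\<And>v. v \<in> V \<Longrightarrow> v + v \<noteq> 0"
  shows "moment1 V 0 = (if odd (card V) then 2 else 0)"
proof -
  have "moment1 V 0 = - 2 * (-1) ^ card V * (\<Sum>v\<in>V. reflected_coeff V v)"
    using assms(1) by (simp add: moment1_def weight_def pole_coeff_conv_reflected_coeff sum_distrib_left mult.assoc)
  then show ?thesis by (simp add: sum_reflected_coeff[OF assms])
qed

text \<open>
  In \<open>moment1 (insert a V) (Suc n) - a * moment1 (insert a V) n\<close> every summand carries a factor
  \<open>v - a\<close>.  It kills the summand of \<open>a\<close>, and in the others it replaces \<open>pole_coeff\<close> for the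
  larger set by \<open>(v + a) * pole_coeff V v\<close>.
\<close>

lemma moment1_insert:
  assumes "finite V" "a \<notin> V"
  shows "moment1 (insert a V) (Suc n) =
    moment1 V (Suc n) + a * moment1 V n + a * moment1 (insert a V) n"
proof -
  let ?W = "insert a V"
  have "moment1 ?W (Suc n) - a * moment1 ?W n = (\<Sum>v\<in>?W. 2 * v ^ n * pole_coeff ?W v * (v - a))"
    by (simp add: moment1_def weight_def sum_distrib_left algebra_simps flip: sum_subtractf)
  also have "\<dots> = (\<Sum>v\<in>V. 2 * v ^ n * pole_coeff ?W v * (v - a))"
    using assms by simp
  also have "\<dots> = (\<Sum>v\<in>V. 2 * v ^ n * pole_coeff V v * (v + a))"
  proof (intro sum.cong refl)
    fix v assume v: "v \<in> V"
    then have "v - a \<noteq> 0" using assms by auto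
    then show "2 * v ^ n * pole_coeff ?W v * (v - a) = 2 * v ^ n * pole_coeff V v * (v + a)"
      by (simp add: pole_coeff_insert[OF assms v])
  qed
  also have "\<dots> = moment1 V (Suc n) + a * moment1 V n"
    by (simp add: moment1_def weight_def sum_distrib_left sum.distrib algebra_simps)
  finally show ?thesis by (simp add: algebra_simps)
qed

text \<open>
  At exponent \<open>0\<close> the two sides disagree: \<open>moment1\<close> is \<open>2\<close> or \<open>0\<close> according to the parity of the
  number of variables.  In the step to exponent \<open>1\<close> these values enter for two sets
  of consecutive sizes, and their sum \<open>2\<close> is what \<open>row_Q\<close> has there.
\<close>

lemma moment1_eq_row_Q:
  fixes xs :: "'a::field list"
  assumes "distinct xs" "\<And>v. v \<in> set xs \<Longrightarrow> v + v \<noteq> 0" "0 < a"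
  shows "moment1 (set xs) a = row_Q xs a"
  using assms
proof (induction xs arbitrary: a)
  case Nil
  then show ?case by (simp add: moment1_def)
next
  case (Cons x xs)
  have x: "x \<notin> set xs" and dist: "distinct xs" using Cons.prems by auto
  have nz: "v + v \<noteq> 0" if "v \<in> insert x (set xs)" for v using Cons.prems that by simp
  have IH: "moment1 (set xs) b = row_Q xs b" if "0 < b" for b
    using Cons.IH dist nz that by blast
  from \<open>0 < a\<close> show ?case
  proof (induction a rule: nat_induct_non_zero)
    case 1
    have "moment1 (set xs) 0 + moment1 (insert x (set xs)) 0 = 2"
      using nz x by (subst (1 2) moment1_0) auto
    then have "x * moment1 (set xs) 0 + x * moment1 (insert x (set xs)) 0 = x * 2"
      by (simp flip: distrib_left)
    then show ?case using moment1_insert[OF _ x, of 0] IH[of 1] by (simp add: add.assoc)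
  next
    case (Suc a)
    then show ?case using moment1_insert[OF _ x, of a] IH[of "Suc a"] IH[of a] by simp
  qed
qed

text \<open>
  Raising one of the exponents by \<open>1\<close> in both possible ways and adding multiplies each summand by
  \<open>u + v\<close>, which is the denominator of the kernel; the double sum becomes a product.
\<close>

lemma moment2_shift:
  assumes "\<And>u v. u \<in> V \<Longrightarrow> v \<in> V \<Longrightarrow> u + v \<noteq> 0"
  shows "moment2 V a (Suc b) + moment2 V (Suc a) b =
    moment1 V a * moment1 V (Suc b) - moment1 V (Suc a) * moment1 V b"
proof -
  have m2: "moment2 V a b = (\<Sum>u\<in>V. \<Sum>v\<in>V. weight V a u * (weight V b v * kernel u v))" for a b
    by (simp add: moment2_def sum_distrib_left)
  have m1: "moment1 V a * moment1 V b = (\<Sum>u\<in>V. \<Sum>v\<in>V. weight V a u * weight V b v)" for a b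
    by (simp add: moment1_def sum_product)
  have pointwise: "weight V a u * (weight V (Suc b) v * kernel u v) + weight V (Suc a) u * (weight V b v * kernel u v) =
    weight V a u * weight V (Suc b) v - weight V (Suc a) u * weight V b v"
    if "u \<in> V" "v \<in> V" for u v
  proof -
    have "(v + u) * kernel u v = v - u" using assms[OF that] by (simp add: kernel_def add.commute)
    then have "weight V a u * weight V b v * ((v + u) * kernel u v) = weight V a u * weight V b v * (v - u)"
      by simp
    then show ?thesis by (simp add: weight_def algebra_simps)
  qed
  show ?thesis
    unfolding m1 m2 sum.distrib[symmetric] sum_subtractf[symmetric]
    by (intro sum.cong refl pointwise)
qed

text \<open>
  The inner sum is the expansion of \<open>\<Prod>\<^sub>v kernel u v\<close>, which vanishes since \<open>u\<close> itself
  belongs to \<open>V\<close>; only the constant term of the expansion is left.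
\<close>

lemma moment2_0:
  assumes "finite V" "\<And>u v. u \<in> V \<Longrightarrow> v \<in> V \<Longrightarrow> u + v \<noteq> 0"
  shows "moment2 V a 0 = (if even (card V) then 2 else 0) * moment1 V a"
proof -
  have "(\<Sum>v\<in>V. weight V 0 v * kernel u v) = (if even (card V) then 2 else 0)" if u: "u \<in> V" for u
  proof -
    have "0 = (\<Prod>v\<in>V. kernel u v)" using assms(1) u by (simp add: kernel_def prod_zero_iff) blast
    also have "\<dots> = (if even (card V) then 1 else 0) + (\<Sum>v\<in>V. reflected_coeff V v * kernel u v)"
      by (rule prod_kernel_expansion) (use assms(1) in simp, (use assms(2) u in blast)+)
    finally have reflected_coeff: "(\<Sum>v\<in>V. reflected_coeff V v * kernel u v) = (if even (card V) then -1 else 0)"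
      by (simp add: eq_neg_iff_add_eq_0 add.commute split: if_splits)
    have "(\<Sum>v\<in>V. weight V 0 v * kernel u v) = - 2 * (-1) ^ card V * (\<Sum>v\<in>V. reflected_coeff V v * kernel u v)"
      using assms(1) by (simp add: weight_def pole_coeff_conv_reflected_coeff sum_distrib_left mult.assoc)
    then show ?thesis by (simp add: reflected_coeff)
  qed
  then show ?thesis by (simp add: moment2_def moment1_def sum_distrib_right mult.commute)
qed

text \<open>
  As for one part, the values at exponent \<open>0\<close> depend on the parity of the number of variables.
  In the step to \<open>b = 1\<close> only the combination
  \<open>moment1 V (Suc a) * moment1 V 0 + moment2 V (Suc a) 0\<close> occurs, and it equals
  \<open>2 * moment1 V (Suc a)\<close> for either parity.
\<close>

lemma moment2_eq_pair_Q:
  fixes xs :: "'a::field list"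
  assumes "distinct xs" and sums: "\<And>u v. u \<in> set xs \<Longrightarrow> v \<in> set xs \<Longrightarrow> u + v \<noteq> 0"
    and "0 < a" "0 < b"
  shows "moment2 (set xs) a b = pair_Q (row_Q xs) a b"
proof -
  let ?V = "set xs"
  have self: "v + v \<noteq> 0" if "v \<in> ?V" for v using sums[OF that that] .
  have m1: "moment1 ?V c = row_Q xs c" if "0 < c" for c
    by (intro moment1_eq_row_Q assms(1) self that)
  have shift: "moment2 ?V a (Suc b) + moment2 ?V (Suc a) b =
      moment1 ?V a * moment1 ?V (Suc b) - moment1 ?V (Suc a) * moment1 ?V b" for a b
    by (intro moment2_shift sums)
  from \<open>0 < b\<close> \<open>0 < a\<close> show ?thesis
  proof (induction b arbitrary: a rule: nat_induct_non_zero)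
    case 1
    have "moment1 ?V (Suc a) * moment1 ?V 0 + moment2 ?V (Suc a) 0 = 2 * moment1 ?V (Suc a)"
      by (subst moment1_0, simp, erule self, subst moment2_0, simp, erule (1) sums) simp
    then have "moment2 ?V a 1 = moment1 ?V a * moment1 ?V 1 - 2 * moment1 ?V (Suc a)"
      using shift[of a 0] by (simp add: algebra_simps)
    then show ?case using 1 by (simp add: m1)
  next
    case (Suc b)
    have "moment2 ?V a (Suc b) =
        moment1 ?V a * moment1 ?V (Suc b) - moment1 ?V (Suc a) * moment1 ?V b - moment2 ?V (Suc a) b"
      using shift[of a b] by (simp add: eq_diff_eq)
    then show ?case using Suc.IH[of "Suc a"] Suc.hyps Suc.prems by (simp add: m1)
  qed
qed

lemma weighted_sum_eq_recursive_Q: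
  fixes xs :: "'a::field list"
  assumes "distinct xs" and sums: "\<And>u v. u \<in> set xs \<Longrightarrow> v \<in> set xs \<Longrightarrow> u + v \<noteq> 0"
    and pos: "\<forall>l\<in>set ls. 0 < l"
  shows "weighted_sum (weight (set xs)) (set xs) ls kernel_prod = recursive_Q xs ls"
proof -
  have "weighted_sum (weight (set xs)) (set xs) ls kernel_prod =
      pfaffian (moment1 (set xs)) (moment2 (set xs)) ls"
    unfolding moment1_def[abs_def] moment2_def[abs_def] by (intro weighted_sum_kernel_prod sums)
  also have "\<dots> = recursive_Q xs ls"
    unfolding recursive_Q_def
  proof (rule pfaffian_cong)
    show "moment1 (set xs) a = row_Q xs a" if "a \<in> set ls" for a
      using pos that by (intro moment1_eq_row_Q assms(1) sums) auto
    show "moment2 (set xs) a b = pair_Q (row_Q xs) a b" if "a \<in> set ls" "b \<in> set ls" for a b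
      using pos that by (intro moment2_eq_pair_Q assms(1) sums) auto
  qed
  finally show ?thesis .
qed

section \<open>The symmetrization over cosets\<close>

lemma X_add_neq_0: "X i + X j \<noteq> 0"
proof -
  have "poly_var i + poly_var j \<noteq> (0 :: cpoly)"
  proof
    assume "poly_var i + poly_var j = (0 :: cpoly)"
    then have "Poly_Mapping.lookup (poly_var i + poly_var j) (Poly_Mapping.single i 1) = 0" by simp
    then show False by (auto simp: poly_var_def lookup_add lookup_single when_def split: if_splits)
  qed
  then show ?thesis by (simp add: X_def Zero_fract_def eq_fract)
qed

lemma inj_X: "inj X"
proof (rule injI)
  fix i j assume "X i = X j"
  then have "poly_var i = poly_var j" by (simp add: X_def eq_fract)
  then have "Poly_Mapping.lookup (poly_var i) (Poly_Mapping.single i 1) =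
      Poly_Mapping.lookup (poly_var j) (Poly_Mapping.single i 1)" by simp
  then have "Poly_Mapping.single j (1::nat) = Poly_Mapping.single i 1"
    by (auto simp: poly_var_def lookup_single when_def split: if_splits)
  then have "Poly_Mapping.lookup (Poly_Mapping.single j (1::nat)) j =
      Poly_Mapping.lookup (Poly_Mapping.single i 1) j" by simp
  then show "i = j" by (auto simp: lookup_single when_def split: if_splits)
qed

text \<open>
  The product of the \<open>pole_coeff\<close> of the chosen variables runs over all ordered pairs of a chosen
  variable and another one.  Compared with the defining product it contains in addition the pairs of
  positions \<open>j < i\<close>, whose factors are cancelled by the kernel product.
\<close>

lemma schur_Q_term_eq_weights:
  assumes \<sigma>: "\<sigma> permutes {..<N}" and len: "length ls \<le> N"
    and vs: "vs = map (\<lambda>i. X (\<sigma> i)) [0..<length ls]"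
  shows "2 ^ length ls * schur_Q_term N ls \<sigma> =
    (\<Prod>i<length ls. weight (X ` {..<N}) (ls ! i) (vs ! i)) * kernel_prod vs"
proof -
  let ?m = "length ls"
  define x where "x i = X (\<sigma> i)" for i
  define r where "r i j = (x i + x j) / (x i - x j)" for i j
  have inj: "inj x"
    unfolding x_def using inj_compose[OF inj_X permutes_inj[OF \<sigma>]] by (simp add: o_def)
  have img: "X ` {..<N} = x ` {..<N}"
    using permutes_image[OF \<sigma>] unfolding x_def by (metis image_image)
  have pole: "pole_coeff (X ` {..<N}) (x i) = (\<Prod>j\<in>{i<..<N}. r i j) * (\<Prod>j<i. r i j)"
    if i: "i < N" for i
  proof -
    have "X ` {..<N} - {x i} = x ` ({..<N} - {i})"
      unfolding img using inj by (auto dest: injD)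
    also have "{..<N} - {i} = {i<..<N} \<union> {..<i}" using i by auto
    finally have "X ` {..<N} - {x i} = x ` ({i<..<N} \<union> {..<i})" .
    moreover have "inj_on x ({i<..<N} \<union> {..<i})" using inj by (rule inj_on_subset) simp
    ultimately have "pole_coeff (X ` {..<N}) (x i) = (\<Prod>j\<in>{i<..<N} \<union> {..<i}. r i j)"
      by (simp only: pole_coeff_def prod.reindex o_def r_def)
    also have "\<dots> = (\<Prod>j\<in>{i<..<N}. r i j) * (\<Prod>j<i. r i j)"
      by (rule prod.union_disjoint) auto
    finally show ?thesis .
  qed
  have cancel: "r i j * kernel (x j) (x i) = 1" if "j < i" for i j
  proof -
    have "x i \<noteq> x j" using that injD[OF inj, of i j] by auto
    moreover have "x i + x j \<noteq> 0" unfolding x_def by (rule X_add_neq_0)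
    ultimately show ?thesis by (simp add: r_def kernel_def add.commute)
  qed
  have "(\<Prod>i<?m. \<Prod>j<i. r i j) * kernel_prod vs = (\<Prod>i<?m. \<Prod>j<i. r i j * kernel (x j) (x i))"
    by (simp add: kernel_prod_conv_prod vs x_def prod.distrib)
  also have "\<dots> = 1" by (simp add: cancel)
  finally have one: "(\<Prod>i<?m. \<Prod>j<i. r i j) * kernel_prod vs = 1" .
  have "(\<Prod>i<?m. weight (X ` {..<N}) (ls ! i) (vs ! i)) =
      (\<Prod>i<?m. 2 * (x i ^ (ls ! i) * (\<Prod>j\<in>{i<..<N}. r i j)) * (\<Prod>j<i. r i j))"
    using len by (intro prod.cong refl) (simp add: weight_def vs pole mult.assoc flip: x_def)
  also have "\<dots> = 2 ^ ?m * schur_Q_term N ls \<sigma> * (\<Prod>i<?m. \<Prod>j<i. r i j)"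
    by (simp add: prod.distrib schur_Q_term_def x_def r_def)
  finally have "(\<Prod>i<?m. weight (X ` {..<N}) (ls ! i) (vs ! i)) * kernel_prod vs =
      2 ^ ?m * schur_Q_term N ls \<sigma> * ((\<Prod>i<?m. \<Prod>j<i. r i j) * kernel_prod vs)"
    by (simp only: mult.assoc)
  then show ?thesis by (simp only: one mult_1_right)
qed

text \<open>
  If \<open>\<sigma>\<close> and \<open>\<tau>\<close> agree below \<open>m\<close>, then \<open>inv \<tau> \<circ> \<sigma>\<close> permutes only \<open>{m..<N}\<close>.
\<close>

lemma perm_coset_eqI:
  fixes N m :: nat
  assumes "\<sigma> permutes {..<N}" "\<tau> permutes {..<N}" "\<And>i. i < m \<Longrightarrow> \<sigma> i = \<tau> i"
  shows "{\<sigma> \<circ> \<pi> | \<pi>. \<pi> permutes {m..<N}} = {\<tau> \<circ> \<pi> | \<pi>. \<pi> permutes {m..<N}}"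
proof -
  have sub: "{\<sigma> \<circ> \<pi> | \<pi>. \<pi> permutes {m..<N}} \<subseteq> {\<tau> \<circ> \<pi> | \<pi>. \<pi> permutes {m..<N}}"
    if \<sigma>: "\<sigma> permutes {..<N}" and \<tau>: "\<tau> permutes {..<N}" and eq: "\<And>i. i < m \<Longrightarrow> \<sigma> i = \<tau> i" for \<sigma> \<tau>
  proof safe
    fix \<pi> assume \<pi>: "\<pi> permutes {m..<N}"
    have "inv \<tau> \<circ> \<sigma> permutes {..<N}"
      using permutes_compose[OF \<sigma> permutes_inv[OF \<tau>]] .
    moreover have "(inv \<tau> \<circ> \<sigma>) i = i" if "i \<in> {..<N} - {m..<N}" for i
    proof -
      have "i < m" using that by auto
      then show ?thesis using permutes_inverses(2)[OF \<tau>, of i] by (simp add: eq)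
    qed
    ultimately have "inv \<tau> \<circ> \<sigma> permutes {m..<N}" by (rule permutes_superset)
    then have "inv \<tau> \<circ> \<sigma> \<circ> \<pi> permutes {m..<N}" using \<pi> by (rule permutes_compose[rotated])
    moreover have "\<sigma> \<circ> \<pi> = \<tau> \<circ> (inv \<tau> \<circ> \<sigma> \<circ> \<pi>)"
      using permutes_inverses(1)[OF \<tau>] by (simp add: fun_eq_iff)
    ultimately show "\<exists>\<pi>'. \<sigma> \<circ> \<pi> = \<tau> \<circ> \<pi>' \<and> \<pi>' permutes {m..<N}" by blast
  qed
  show ?thesis using assms sub[of \<sigma> \<tau>] sub[of \<tau> \<sigma>] by (intro equalityI) auto
qed

lemma perm_coset_representative:
  assumes "C \<in> perm_cosets N m"
  defines "\<sigma> \<equiv> SOME \<sigma>. \<sigma> \<in> C"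
  shows "\<sigma> permutes {..<N}" "C = {\<sigma> \<circ> \<pi> | \<pi>. \<pi> permutes {m..<N}}"
proof -
  obtain \<tau> where \<tau>: "\<tau> permutes {..<N}" and C: "C = {\<tau> \<circ> \<pi> | \<pi>. \<pi> permutes {m..<N}}"
    using assms(1) unfolding perm_cosets_def by auto
  have "\<tau> \<circ> id \<in> C" unfolding C using permutes_id by blast
  then have "\<sigma> \<in> C" unfolding \<sigma>_def by (rule someI[of "\<lambda>\<sigma>. \<sigma> \<in> C"])
  then obtain \<pi> where \<pi>: "\<pi> permutes {m..<N}" "\<sigma> = \<tau> \<circ> \<pi>" unfolding C by auto
  have "\<pi> permutes {..<N}" using \<pi>(1) by (rule permutes_subset) auto
  then show \<sigma>: "\<sigma> permutes {..<N}" unfolding \<pi>(2) using \<tau> by (rule permutes_compose)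
  have "\<tau> i = \<sigma> i" if "i < m" for i
    using permutes_not_in[OF \<pi>(1), of i] that by (simp add: \<pi>(2))
  with \<tau> \<sigma> show "C = {\<sigma> \<circ> \<pi> | \<pi>. \<pi> permutes {m..<N}}"
    unfolding C by (rule perm_coset_eqI)
qed

lemma distinct_list_extends_to_permutation:
  assumes "distinct is" "set is \<subseteq> {..<N}"
  obtains \<sigma> where "\<sigma> permutes {..<N}" "\<And>i. i < length is \<Longrightarrow> \<sigma> i = is ! i"
proof -
  let ?m = "length is"
  have card: "?m = card (set is)" using assms(1) by (simp add: distinct_card)
  have len: "?m \<le> N" unfolding card using card_mono[OF _ assms(2)] by simp
  have "card {?m..<N} = card ({..<N} - set is)"
    using assms(2) by (simp add: card_Diff_subset card[symmetric])
  then obtain g where g: "bij_betw g {?m..<N} ({..<N} - set is)"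
    using finite_same_card_bij[of "{?m..<N}" "{..<N} - set is"] by auto
  define \<sigma> where "\<sigma> i = (if i < ?m then is ! i else if i < N then g i else i)" for i
  have "bij_betw \<sigma> {..<?m} (set is)"
    using bij_betw_nth[OF assms(1) refl refl] by (subst bij_betw_cong[of _ _ "(!) is"]) (auto simp: \<sigma>_def)
  moreover have "bij_betw \<sigma> {?m..<N} ({..<N} - set is)"
    using g by (subst bij_betw_cong[of _ _ g]) (auto simp: \<sigma>_def)
  ultimately have "bij_betw \<sigma> ({..<?m} \<union> {?m..<N}) (set is \<union> ({..<N} - set is))"
    by (rule bij_betw_combine) auto
  moreover have "{..<?m} \<union> {?m..<N} = {..<N}" using len by auto
  moreover have "set is \<union> ({..<N} - set is) = {..<N}" using assms(2) by auto
  ultimately have "bij_betw \<sigma> {..<N} {..<N}" by simp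
  then have "\<sigma> permutes {..<N}"
    by (rule bij_imp_permutes) (use len in \<open>auto simp: \<sigma>_def\<close>)
  then show thesis by (rule that) (simp add: \<sigma>_def)
qed

text \<open>
  Cosets correspond to lists of distinct variables of length \<open>m\<close>.  Lists with repetitions may be
  added because their kernel product vanishes.
\<close>

lemma schur_Q_fract_eq_recursive_Q:
  assumes "length ls \<le> N" "\<forall>l\<in>set ls. 0 < l"
  shows "schur_Q_fract N ls = recursive_Q (map X [0..<N]) ls"
proof -
  let ?m = "length ls" and ?V = "X ` {..<N}"
  let ?D = "{vs. set vs \<subseteq> ?V \<and> length vs = ?m \<and> distinct vs}"
  define F where "F \<sigma> = map (\<lambda>i. X (\<sigma> i)) [0..<?m]" for \<sigma>
  define rep :: "(nat \<Rightarrow> nat) set \<Rightarrow> nat \<Rightarrow> nat" where "rep C = (SOME \<sigma>. \<sigma> \<in> C)" for C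
  define G where "G vs = (\<Prod>i<?m. weight ?V (ls ! i) (vs ! i)) * kernel_prod vs" for vs
  have rep: "rep C permutes {..<N}" "C = {rep C \<circ> \<pi> | \<pi>. \<pi> permutes {?m..<N}}"
    if "C \<in> perm_cosets N ?m" for C
    unfolding rep_def using perm_coset_representative[OF that] .
  have F_eq_iff: "F \<sigma> = F \<tau> \<longleftrightarrow> (\<forall>i<?m. \<sigma> i = \<tau> i)" for \<sigma> \<tau>
    by (auto simp: F_def inj_eq[OF inj_X])
  have bij: "bij_betw (\<lambda>C. F (rep C)) (perm_cosets N ?m) ?D"
  proof (rule bij_betw_imageI)
    show "inj_on (\<lambda>C. F (rep C)) (perm_cosets N ?m)"
    proof (rule inj_onI)
      fix C D assume C: "C \<in> perm_cosets N ?m" and D: "D \<in> perm_cosets N ?m"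
        and "F (rep C) = F (rep D)"
      then have "{rep C \<circ> \<pi> | \<pi>. \<pi> permutes {?m..<N}} = {rep D \<circ> \<pi> | \<pi>. \<pi> permutes {?m..<N}}"
        by (intro perm_coset_eqI rep) (auto simp: F_eq_iff)
      then show "C = D" using rep(2)[OF C] rep(2)[OF D] by simp
    qed
    show "(\<lambda>C. F (rep C)) ` perm_cosets N ?m = ?D"
    proof (intro equalityI subsetI)
      fix vs assume "vs \<in> (\<lambda>C. F (rep C)) ` perm_cosets N ?m"
      then obtain C where C: "C \<in> perm_cosets N ?m" and vs: "vs = F (rep C)" by auto
      have "inj (\<lambda>i. X (rep C i))"
        using inj_compose[OF inj_X permutes_inj[OF rep(1)[OF C]]] by (simp add: o_def)
      then have "distinct vs" unfolding vs F_def
        by (auto simp: distinct_map intro: inj_on_subset)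
      moreover have "rep C i < N" if "i < ?m" for i
        using permutes_in_image[OF rep(1)[OF C], of i] that assms(1) by auto
      ultimately show "vs \<in> ?D" by (auto simp: vs F_def)
    next
      fix vs assume vs: "vs \<in> ?D"
      define ks where "ks = map (inv_into {..<N} X) vs"
      have vs_ks: "vs = map X ks"
        unfolding ks_def map_map using vs by (intro map_idI[symmetric]) (auto simp: f_inv_into_f)
      have "set ks \<subseteq> {..<N}" using vs inv_into_into[of _ X "{..<N}"] by (auto simp: ks_def)
      moreover have "distinct ks" using vs unfolding vs_ks by (auto simp: distinct_map)
      ultimately obtain \<sigma> where \<sigma>: "\<sigma> permutes {..<N}" "\<And>i. i < length ks \<Longrightarrow> \<sigma> i = ks ! i"
        using distinct_list_extends_to_permutation by blast
      define C where "C = {\<sigma> \<circ> \<pi> | \<pi>. \<pi> permutes {?m..<N}}"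
      have C: "C \<in> perm_cosets N ?m" using \<sigma>(1) by (auto simp: perm_cosets_def C_def)
      have "rep C \<circ> id \<in> C" using rep(2)[OF C] permutes_id by blast
      then obtain \<pi> where \<pi>: "\<pi> permutes {?m..<N}" "rep C = \<sigma> \<circ> \<pi>" by (auto simp: C_def)
      have "rep C i = \<sigma> i" if "i < ?m" for i
        using permutes_not_in[OF \<pi>(1), of i] that by (simp add: \<pi>(2))
      then have "F (rep C) = F \<sigma>" by (simp add: F_eq_iff)
      also have "\<dots> = vs"
      proof (rule nth_equalityI)
        have len: "length vs = ?m" "length ks = ?m" using vs by (simp_all add: ks_def)
        then show "length (F \<sigma>) = length vs" by (simp add: F_def)
        show "F \<sigma> ! i = vs ! i" if "i < length (F \<sigma>)" for i
          using that \<sigma>(2)[of i] len by (simp add: F_def) (simp add: vs_ks)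
      qed
      finally show "vs \<in> (\<lambda>C. F (rep C)) ` perm_cosets N ?m" using C by blast
    qed
  qed
  have "schur_Q_fract N ls = (\<Sum>C\<in>perm_cosets N ?m. 2 ^ ?m * schur_Q_term N ls (rep C))"
    by (simp add: schur_Q_fract_def rep_def sum_distrib_left)
  also have "\<dots> = (\<Sum>C\<in>perm_cosets N ?m. G (F (rep C)))"
    unfolding G_def using assms(1)
    by (intro sum.cong refl schur_Q_term_eq_weights rep) (auto simp: F_def)
  also have "\<dots> = (\<Sum>vs\<in>?D. G vs)" using bij by (rule sum.reindex_bij_betw)
  also have "\<dots> = (\<Sum>vs | set vs \<subseteq> ?V \<and> length vs = ?m. G vs)"
    by (intro sum.mono_neutral_left finite_lists_length_eq) (auto simp: G_def kernel_prod_not_distinct)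
  also have "\<dots> = weighted_sum (weight ?V) ?V ls kernel_prod"
    unfolding G_def by (rule weighted_sum_conv_sum_lists[symmetric]) simp
  also have "\<dots> = weighted_sum (weight (set (map X [0..<N]))) (set (map X [0..<N])) ls kernel_prod"
    by (simp add: atLeast0LessThan)
  also have "\<dots> = recursive_Q (map X [0..<N]) ls"
    using inj_on_subset[OF inj_X] assms(2)
    by (intro weighted_sum_eq_recursive_Q) (auto simp: distinct_map X_add_neq_0)
  finally show ?thesis .
qed

section \<open>Evaluation of polynomials\<close>

definition monom_eval :: "(nat \<Rightarrow> complex) \<Rightarrow> (nat \<Rightarrow>\<^sub>0 nat) \<Rightarrow> complex" where
  "monom_eval a \<mu> = (\<Prod>i\<in>Poly_Mapping.keys \<mu>. a i ^ Poly_Mapping.lookup \<mu> i)"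

lemma monom_eval_superset:
  assumes "finite K" "Poly_Mapping.keys \<mu> \<subseteq> K"
  shows "monom_eval a \<mu> = (\<Prod>i\<in>K. a i ^ Poly_Mapping.lookup \<mu> i)"
  unfolding monom_eval_def using assms
  by (intro prod.mono_neutral_left) (auto simp: in_keys_iff)

lemma monom_eval_add: "monom_eval a (\<mu> + \<nu>) = monom_eval a \<mu> * monom_eval a \<nu>"
proof -
  let ?K = "Poly_Mapping.keys \<mu> \<union> Poly_Mapping.keys \<nu>"
  have "monom_eval a \<rho> = (\<Prod>i\<in>?K. a i ^ Poly_Mapping.lookup \<rho> i)" if "\<rho> \<in> {\<mu>, \<nu>, \<mu> + \<nu>}" for \<rho>
    using that keys_add[of \<mu> \<nu>] by (intro monom_eval_superset) auto
  then show ?thesis by (simp add: lookup_add power_add prod.distrib)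
qed

text \<open>
  Summing over a common finite set of monomials lets different polynomials be compared.
\<close>

lemma poly_eval_superset:
  assumes "finite K" "Poly_Mapping.keys p \<subseteq> K"
  shows "poly_eval a p = (\<Sum>\<mu>\<in>K. Poly_Mapping.lookup p \<mu> * monom_eval a \<mu>)"
  unfolding poly_eval_def monom_eval_def[symmetric] using assms
  by (intro sum.mono_neutral_left) (auto simp: in_keys_iff)

lemma poly_eval_add: "poly_eval a (p + q) = poly_eval a p + poly_eval a q"
proof -
  let ?K = "Poly_Mapping.keys p \<union> Poly_Mapping.keys q"
  have "poly_eval a r = (\<Sum>\<mu>\<in>?K. Poly_Mapping.lookup r \<mu> * monom_eval a \<mu>)" if "r \<in> {p, q, p + q}" for r
    using that keys_add[of p q] by (intro poly_eval_superset) auto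
  then show ?thesis by (simp add: lookup_add distrib_right sum.distrib)
qed

lemma poly_eval_single: "poly_eval a (Poly_Mapping.single \<mu> c) = c * monom_eval a \<mu>"
  using poly_eval_superset[of "{\<mu>}" "Poly_Mapping.single \<mu> c" a] by simp

lemma poly_mapping_single_induct [case_names zero single_add]:
  fixes p :: "'k \<Rightarrow>\<^sub>0 'c::ab_group_add"
  assumes "P 0" and step: "\<And>k c p. P p \<Longrightarrow> P (Poly_Mapping.single k c + p)"
  shows "P p"
proof (induction p rule: update_induct)
  case (update f k c)
  have "Poly_Mapping.update k c f = Poly_Mapping.single k c + f"
    using update.hyps by (intro poly_mapping_eqI)
      (auto simp: lookup_update lookup_add lookup_single when_def not_in_keys_iff_lookup_eq_zero)
  then show ?case using step update.IH by simp
qed (fact assms(1))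

lemma poly_eval_mult: "poly_eval a (p * q) = poly_eval a p * poly_eval a q"
proof (induction p rule: poly_mapping_single_induct)
  case (single_add \<mu> c p)
  have "poly_eval a (Poly_Mapping.single \<mu> c * q) = c * monom_eval a \<mu> * poly_eval a q"
  proof (induction q rule: poly_mapping_single_induct)
    case (single_add \<nu> d q)
    then show ?case
      by (simp add: distrib_left poly_eval_add mult_single poly_eval_single monom_eval_add)
  qed (simp add: poly_eval_def)
  with single_add show ?case by (simp add: distrib_right poly_eval_add poly_eval_single)
qed (simp add: poly_eval_def)

lemma comm_ring_hom_poly_eval: "comm_ring_hom (poly_eval a)"
proof
  show "poly_eval a 1 = 1" using poly_eval_single[of a 0 1] by (simp add: monom_eval_def)
qed (fact poly_eval_add poly_eval_mult)+

lemma poly_eval_poly_var: "poly_eval a (poly_var i) = a i"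
  by (simp add: poly_var_def poly_eval_single monom_eval_def)

lemma comm_ring_hom_Fract: "comm_ring_hom (\<lambda>p :: cpoly. Fract p 1)"
  by unfold_locales (simp_all add: One_fract_def)

text \<open>
  The rational function is the image of a polynomial, namely of \<open>recursive_Q\<close> formed in the
  polynomial ring; since the embedding into the fraction field is injective, this is the
  polynomial singled out in the definition of \<open>schur_Q\<close>.
\<close>

lemma schur_Q_eq_recursive_Q:
  assumes "length ls \<le> N" "\<forall>l\<in>set ls. 0 < l"
  shows "schur_Q N ls = recursive_Q (map poly_var [0..<N]) ls"
proof -
  have "schur_Q_fract N ls = recursive_Q (map (\<lambda>p. Fract p 1) (map poly_var [0..<N])) ls"
    using schur_Q_fract_eq_recursive_Q[OF assms] by (simp add: X_def[abs_def] o_def)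
  also have "\<dots> = Fract (recursive_Q (map poly_var [0..<N]) ls) 1"
    by (rule comm_ring_hom.recursive_Q[OF comm_ring_hom_Fract, symmetric])
  finally have "schur_Q_fract N ls = Fract (recursive_Q (map poly_var [0..<N]) ls) 1" .
  then show ?thesis unfolding schur_Q_def by (intro the_equality) (simp_all add: eq_fract)
qed

section \<open>Principal specialization of the recursion\<close>

text \<open>
  The distance \<open>e n\<close> of \<open>s n\<close> to the fixed point of the limiting recurrence satisfies
  \<open>e (n + 1) \<le> |c| e n + |d n - D|\<close>, so it decays geometrically up to an error that becomes
  arbitrarily small.
\<close>

lemma tendsto_affine_recurrence:
  fixes s d :: "nat \<Rightarrow> 'a::real_normed_field"
  assumes c: "norm c < 1" and step: "\<And>n. s (Suc n) = c * s n + d n" and d: "d \<longlonglongrightarrow> D"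
  shows "s \<longlonglongrightarrow> D / (1 - c)"
proof -
  define e where "e n = norm (s n - D / (1 - c))" for n
  have c1: "1 - c \<noteq> 0" using c by auto
  have e_step: "e (Suc n) \<le> norm c * e n + norm (d n - D)" for n
  proof -
    have "s (Suc n) - D / (1 - c) = c * (s n - D / (1 - c)) + (d n - D)"
      using c1 by (simp add: step field_simps)
    then show ?thesis unfolding e_def by (metis norm_mult norm_triangle_ineq)
  qed
  have "e \<longlonglongrightarrow> 0"
  proof (rule LIMSEQ_I)
    fix r :: real assume "0 < r"
    \<comment> \<open>With perturbations below \<open>\<epsilon>\<close> the bound \<open>r / 2\<close> is preserved by the recurrence:
      \<open>norm c * (r / 2) + \<epsilon> = r / 2\<close>.\<close>
    define \<epsilon> where "\<epsilon> = r / 2 * (1 - norm c)"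
    have \<epsilon>: "0 < \<epsilon>" using \<open>0 < r\<close> c by (simp add: \<epsilon>_def)
    obtain M where M: "norm (d n - D) < \<epsilon>" if "n \<ge> M" for n
      using LIMSEQ_D[OF d \<epsilon>] by blast
    have geom: "e (M + k) \<le> norm c ^ k * e M + r / 2" for k
    proof (induction k)
      case (Suc k)
      have "e (M + Suc k) \<le> norm c * e (M + k) + \<epsilon>"
        using e_step[of "M + k"] M[of "M + k"] by simp
      also have "\<dots> \<le> norm c * (norm c ^ k * e M + r / 2) + \<epsilon>"
        using Suc by (intro add_right_mono mult_left_mono) auto
      also have "\<dots> = norm c ^ Suc k * e M + r / 2" by (simp add: \<epsilon>_def field_simps)
      finally show ?case .
    qed (use \<open>0 < r\<close> in simp)
    have "(\<lambda>k. norm c ^ k * e M) \<longlonglongrightarrow> 0"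
      using c by (intro tendsto_mult_left_zero LIMSEQ_power_zero) simp
    then obtain K where K: "norm (norm c ^ k * e M - 0) < r / 2" if "k \<ge> K" for k
      using LIMSEQ_D[of _ 0 "r / 2"] \<open>0 < r\<close> by (metis half_gt_zero)
    show "\<exists>no. \<forall>n\<ge>no. norm (e n - 0) < r"
    proof (intro exI[of _ "M + K"] allI impI)
      fix n assume n: "M + K \<le> n"
      then have "K \<le> n - M" by linarith
      then have "norm c ^ (n - M) * e M < r / 2" using K[of "n - M"] by auto
      then have "e n < r" using geom[of "n - M"] n by simp
      then show "norm (e n - 0) < r" by (simp add: e_def)
    qed
  qed
  then have "(\<lambda>n. s n - D / (1 - c)) \<longlonglongrightarrow> 0"
    unfolding e_def by (rule tendsto_norm_zero_cancel)
  then show ?thesis by (simp add: LIM_zero_iff)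
qed

lemma row_Q_scale: "row_Q (map (\<lambda>x. c * x) xs) a = c ^ a * row_Q xs a"
  by (induction xs a rule: row_Q.induct) (simp_all add: algebra_simps)

definition q_powers :: "'r::comm_ring_1 \<Rightarrow> nat \<Rightarrow> 'r list" where
  "q_powers q n = map (\<lambda>i. q ^ i) [0..<n]"

text \<open>
  Apart from the first one, the powers of \<open>q\<close> are \<open>q\<close> times the powers of \<open>q\<close>; with homogeneity
  this turns the recursion over variables into a recurrence in their number.
\<close>

lemma q_powers_Suc: "q_powers q (Suc n) = 1 # map (\<lambda>x. q * x) (q_powers q n)"
  by (simp add: q_powers_def upt_conv_Cons map_Suc_upt[symmetric] o_def del: upt_Suc)

definition row_limit :: "complex \<Rightarrow> nat \<Rightarrow> complex" where
  "row_limit q a = qpoch (-1) q a / qpoch q q a"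

lemma one_minus_power_neq_0:
  fixes q :: complex
  assumes "norm q < 1" "0 < a"
  shows "1 - q ^ a \<noteq> 0"
proof -
  have "norm (q ^ a) < 1" using assms by (simp add: norm_power power_less_one_iff)
  then show ?thesis by auto
qed

lemma row_limit_Suc:
  "row_limit q (Suc a) = row_limit q a * ((1 + q ^ a) / (1 - q ^ Suc a))"
  by (simp add: row_limit_def qpoch_def mult_ac)

text \<open>
  In terms of generating functions, \<open>G\<^sub>n(t) = \<Prod>\<^bsub>i<n\<^esub> (1 + q\<^sup>i t) / (1 - q\<^sup>i t)\<close> satisfies
  \<open>(1 - t) G\<^bsub>n+1\<^esub>(t) = (1 + t) G\<^sub>n(q t)\<close>.  For the coefficient of \<open>t\<^bsup>a+1\<^esup>\<close> this
  is an affine recurrence in \<open>n\<close> with factor \<open>q\<^bsup>a+1\<^esup>\<close>, whose inhomogeneous part converges by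
  induction on \<open>a\<close>.
\<close>

lemma tendsto_row_Q:
  assumes q: "norm q < 1"
  shows "(\<lambda>n. row_Q (q_powers q n) a) \<longlonglongrightarrow> row_limit q a"
proof (induction a)
  case 0
  show ?case by (simp add: row_limit_def qpoch_def)
next
  case (Suc a)
  have "norm (q ^ Suc a) < 1"
    using q by (simp add: norm_power power_less_one_iff del: power_Suc)
  moreover have "row_Q (q_powers q (Suc n)) (Suc a) = q ^ Suc a * row_Q (q_powers q n) (Suc a) +
      (q ^ a * row_Q (q_powers q n) a + row_Q (q_powers q (Suc n)) a)" for n
    by (simp only: q_powers_Suc row_Q.simps row_Q_scale) simp
  moreover have "(\<lambda>n. q ^ a * row_Q (q_powers q n) a + row_Q (q_powers q (Suc n)) a)
      \<longlonglongrightarrow> q ^ a * row_limit q a + row_limit q a"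
    by (intro tendsto_intros Suc LIMSEQ_Suc)
  ultimately have "(\<lambda>n. row_Q (q_powers q n) (Suc a)) \<longlonglongrightarrow>
      (q ^ a * row_limit q a + row_limit q a) / (1 - q ^ Suc a)"
    by (rule tendsto_affine_recurrence)
  then show ?case unfolding row_limit_Suc by (simp add: algebra_simps)
qed

definition pair_factor :: "complex \<Rightarrow> nat \<Rightarrow> nat \<Rightarrow> complex" where
  "pair_factor q a b = (q ^ b - q ^ a) / (1 - q ^ (a + b))"

text \<open>
  The claimed limits for two parts satisfy the recursion of \<open>pair_Q\<close>.  After division by
  \<open>row_limit q a * row_limit q b\<close> this is an identity of rational functions in \<open>q\<close>,
  \<open>u = q\<^sup>a\<close> and \<open>v = q\<^sup>b\<close>.
\<close>

lemma pair_limit_recurrence: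
  assumes q: "norm q < 1" and "0 < a"
  shows "row_limit q a * row_limit q (Suc b) * pair_factor q a (Suc b) =
    row_limit q a * row_limit q (Suc b) - row_limit q (Suc a) * row_limit q b -
    row_limit q (Suc a) * row_limit q b * pair_factor q (Suc a) b"
proof -
  define u v where "u = q ^ a" and "v = q ^ b"
  have nz: "1 - q * u \<noteq> 0" "1 - q * v \<noteq> 0" "1 - q * (u * v) \<noteq> 0"
    using one_minus_power_neq_0[OF q, of "Suc a"] one_minus_power_neq_0[OF q, of "Suc b"]
      one_minus_power_neq_0[OF q, of "Suc (a + b)"]
    by (simp_all add: u_def v_def power_add)
  \<comment> \<open>Both sides equal \<open>(1 + u) * (1 + v) / (1 - q * (u * v))\<close>.\<close>
  have "(1 + v) / (1 - q * v) * (1 - (q * v - u) / (1 - q * (u * v))) =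
      (1 + u) / (1 - q * u) * (1 + (v - q * u) / (1 - q * (u * v)))"
  proof -
    have "1 - (q * v - u) / (1 - q * (u * v)) = (1 + u) * (1 - q * v) / (1 - q * (u * v))"
      using nz(3) by (simp add: divide_simps) (simp add: algebra_simps)
    moreover have "1 + (v - q * u) / (1 - q * (u * v)) = (1 + v) * (1 - q * u) / (1 - q * (u * v))"
      using nz(3) by (simp add: divide_simps) (simp add: algebra_simps)
    ultimately show ?thesis using nz(1,2) by simp
  qed
  then have "row_limit q a * row_limit q b *
      ((1 + v) / (1 - q * v) * (1 - (q * v - u) / (1 - q * (u * v)))) =
      row_limit q a * row_limit q b *
      ((1 + u) / (1 - q * u) * (1 + (v - q * u) / (1 - q * (u * v))))" by simp
  moreover have "pair_factor q a (Suc b) = (q * v - u) / (1 - q * (u * v))"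
    "pair_factor q (Suc a) b = (v - q * u) / (1 - q * (u * v))"
    by (simp_all add: pair_factor_def u_def v_def power_add mult.left_commute)
  ultimately show ?thesis
    unfolding row_limit_Suc power_Suc u_def[symmetric] v_def[symmetric]
    by (simp only: right_diff_distrib distrib_left mult_1_right mult_ac) (simp add: algebra_simps)
qed

lemma tendsto_pair_Q:
  assumes q: "norm q < 1" and "0 < a"
  shows "(\<lambda>n. pair_Q (row_Q (q_powers q n)) a b) \<longlonglongrightarrow> row_limit q a * row_limit q b * pair_factor q a b"
  using \<open>0 < a\<close>
proof (induction b arbitrary: a)
  case 0
  have "pair_factor q a 0 = 1" using one_minus_power_neq_0[OF q \<open>0 < a\<close>] by (simp add: pair_factor_def)
  moreover have "row_limit q 0 = 1" by (simp add: row_limit_def qpoch_def)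
  ultimately show ?case using tendsto_row_Q[OF q, of a] by simp
next
  case (Suc b)
  have "(\<lambda>n. pair_Q (row_Q (q_powers q n)) a (Suc b)) \<longlonglongrightarrow>
    row_limit q a * row_limit q (Suc b) - row_limit q (Suc a) * row_limit q b -
    row_limit q (Suc a) * row_limit q b * pair_factor q (Suc a) b"
    unfolding pair_Q.simps by (intro tendsto_intros tendsto_row_Q q Suc.IH) simp
  then show ?case unfolding pair_limit_recurrence[OF q Suc.prems] .
qed

text \<open>
  The substitution \<open>u a = (1 + q ^ a) / (1 - q ^ a)\<close> turns \<open>pair_factor q a b\<close> into
  \<open>kernel (u a) (u b)\<close>, and Schur's expansion gives the product form.
\<close>

lemma pfaffian_pair_factor:
  assumes q: "norm q < 1" and pos: "\<forall>l\<in>set ls. 0 < l"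
  shows "pfaffian (row_limit q) (\<lambda>a b. row_limit q a * row_limit q b * pair_factor q a b) ls =
    (\<Prod>i<length ls. row_limit q (ls ! i)) *
    (\<Prod>i<length ls. \<Prod>j\<in>{i<..<length ls}. pair_factor q (ls ! i) (ls ! j))"
proof -
  define u where "u a = (1 + q ^ a) / (1 - q ^ a)" for a
  have sum: "u a + u b = 2 * (1 - q ^ (a + b)) / ((1 - q ^ a) * (1 - q ^ b))"
    and diff: "u b - u a = 2 * (q ^ b - q ^ a) / ((1 - q ^ a) * (1 - q ^ b))"
    and nz: "1 - q ^ a \<noteq> 0" "1 - q ^ b \<noteq> 0" "1 - q ^ (a + b) \<noteq> 0"
    if "a \<in> set ls" "b \<in> set ls" for a b
  proof -
    show nz: "1 - q ^ a \<noteq> 0" "1 - q ^ b \<noteq> 0" "1 - q ^ (a + b) \<noteq> 0"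
      using that pos by (auto intro!: one_minus_power_neq_0[OF q] simp del: right_minus_eq)
    show "u a + u b = 2 * (1 - q ^ (a + b)) / ((1 - q ^ a) * (1 - q ^ b))"
      unfolding u_def using nz by (simp add: power_add divide_simps) (simp add: algebra_simps)
    show "u b - u a = 2 * (q ^ b - q ^ a) / ((1 - q ^ a) * (1 - q ^ b))"
      unfolding u_def using nz by (simp add: divide_simps) (simp add: algebra_simps)
  qed
  have kernel: "kernel (u a) (u b) = pair_factor q a b" if "a \<in> set ls" "b \<in> set ls" for a b
  proof -
    have cancel: "(2 * x / d) / (2 * y / d) = x / y" if "d \<noteq> 0" for x y d :: complex
      using that by simp
    show ?thesis unfolding kernel_def pair_factor_def sum[OF that] diff[OF that]
      by (rule cancel) (use nz[OF that] in simp)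
  qed
  have "pfaffian (row_limit q) (\<lambda>a b. row_limit q a * row_limit q b * pair_factor q a b) ls =
      pfaffian (row_limit q) (\<lambda>a b. row_limit q a * row_limit q b * kernel (u a) (u b)) ls"
    by (rule pfaffian_cong) (simp_all add: kernel)
  also have "\<dots> = (\<Prod>l\<leftarrow>ls. row_limit q l) * kernel_prod (map u ls)"
  proof (rule pfaffian_kernel)
    show "u a + u b \<noteq> 0" if "a \<in> set ls" "b \<in> set ls" for a b
      unfolding sum[OF that] using nz[OF that] by simp
  qed
  also have "(\<Prod>l\<leftarrow>ls. row_limit q l) = (\<Prod>i<length ls. row_limit q (ls ! i))"
    by (simp add: prod.list_conv_set_nth atLeast0LessThan)
  also have "kernel_prod (map u ls) = (\<Prod>j<length ls. \<Prod>i<j. pair_factor q (ls ! i) (ls ! j))"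
    by (simp add: kernel_prod_conv_prod kernel)
  also have "\<dots> = (\<Prod>j<length ls. \<Prod>i | i \<in> {..<length ls} \<and> i < j. pair_factor q (ls ! i) (ls ! j))"
    by (intro prod.cong) auto
  also have "\<dots> = (\<Prod>i<length ls. \<Prod>j | j \<in> {..<length ls} \<and> i < j. pair_factor q (ls ! i) (ls ! j))"
    by (rule prod.swap_restrict) simp_all
  also have "\<dots> = (\<Prod>i<length ls. \<Prod>j\<in>{i<..<length ls}. pair_factor q (ls ! i) (ls ! j))"
    by (intro prod.cong) auto
  finally show ?thesis .
qed

section \<open>The limit formula\<close>

theorem proposition3p1:
  fixes q :: complex and ls :: "nat list"
  assumes "norm q < 1" and "is_partition ls"
  shows "(\<lambda>n. poly_eval (\<lambda>i. q ^ i) (schur_Q (Suc n) ls)) \<longlonglongrightarrow>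
    (\<Prod>i<length ls. qpoch (-1) q (ls ! i) / qpoch q q (ls ! i)) *
    (\<Prod>i<length ls. \<Prod>j\<in>{i<..<length ls}.
       (q ^ (ls ! j) - q ^ (ls ! i)) / (1 - q ^ (ls ! i + ls ! j)))"
proof -
  have pos: "\<forall>l\<in>set ls. 0 < l" using assms(2) by (simp add: is_partition_def)
  have eval: "poly_eval (\<lambda>i. q ^ i) (schur_Q N ls) = recursive_Q (q_powers q N) ls" if "length ls \<le> N" for N
    using comm_ring_hom.recursive_Q[OF comm_ring_hom_poly_eval, of "\<lambda>i. q ^ i"]
    by (simp add: schur_Q_eq_recursive_Q[OF that pos] q_powers_def o_def poly_eval_poly_var)
  have "(\<lambda>n. recursive_Q (q_powers q n) ls) \<longlonglongrightarrow> pfaffian (row_limit q)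
      (\<lambda>a b. row_limit q a * row_limit q b * pair_factor q a b) ls"
    unfolding recursive_Q_def using pos
    by (intro tendsto_pfaffian tendsto_row_Q tendsto_pair_Q assms(1)) auto
  then have "(\<lambda>n. recursive_Q (q_powers q n) ls) \<longlonglongrightarrow>
    (\<Prod>i<length ls. row_limit q (ls ! i)) *
    (\<Prod>i<length ls. \<Prod>j\<in>{i<..<length ls}. pair_factor q (ls ! i) (ls ! j))"
    unfolding pfaffian_pair_factor[OF assms(1) pos] .
  then have "(\<lambda>n. recursive_Q (q_powers q (Suc n)) ls) \<longlonglongrightarrow>
    (\<Prod>i<length ls. row_limit q (ls ! i)) *
    (\<Prod>i<length ls. \<Prod>j\<in>{i<..<length ls}. pair_factor q (ls ! i) (ls ! j))"
    by (rule LIMSEQ_Suc)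
  moreover have "\<forall>\<^sub>F n in sequentially. recursive_Q (q_powers q (Suc n)) ls =
      poly_eval (\<lambda>i. q ^ i) (schur_Q (Suc n) ls)"
    using eventually_ge_at_top[of "length ls"] by eventually_elim (simp add: eval)
  ultimately show ?thesis unfolding row_limit_def pair_factor_def by (rule Lim_transform_eventually)
qed

end
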